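(* Let $\lambda>0$, $\alpha>2$, $R_{\rm d}>1$, ${\rm SNR}>0$ and let $N_{\rm r}\ge1$ be an integer. Assume that the receive antenna correlation matrix ${\bf C}\in\mathbb{R}^{N_{\rm r}\times N_{\rm r}}$ has non-zero (positive) eigenvalues $\mu_1\ge\mu_2\ge\cdots\ge\mu_{{\rm rk}({\bf C})}$, counted with multiplicity, where $1\le {\rm rk}({\bf C})\le N_{\rm r}$. Then the sum spectral efficiency with direct CSIR (maximum ratio combining) under antenna correlation, $C_\Sigma^{\rm mrc}=\lambda\,\mathbb{E}\left[\log_2(1+{\rm SINR}^{\rm mrc})\right]$, satisfies $$C_{\Sigma}^{\rm mrc}\ge\frac{\lambda}{\ln 2}\int_{1}^{R_{\rm d}}\int_{0}^{\infty}\frac{\left(1-\prod_{n=1}^{{\rm rk}({\bf C})}\frac{1}{1+\mu_n z x^{-\alpha}}\right)\exp\left(-\frac{\mu_1^{\frac{2}{\alpha}}\lambda\pi}{{\rm sinc}\left(\frac{2}{\alpha}\right)}z^{\frac{2}{\alpha}}\right)}{z\exp\left(\frac{z}{\rm SNR}\right)}\,{\rm d}z\;\frac{2x}{R_{\rm d}^2-1}\,{\rm d}x .$$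
   Context: Convention: ${\rm sinc}(x)=\frac{\sin(\pi x)}{\pi x}$. Network model. Single-antenna transmitters form a homogeneous Poisson point process (PPP) of density $\lambda$ in $\mathbb{R}^2$. Each transmitter has its own receiver with $N_{\rm r}$ antennas, located uniformly (with respect to area) in the annulus centred at the transmitter with inner radius $1$ and outer radius $R_{\rm d}$. Quantities of the typical link (i.e. under the Palm distribution) are as follows: - The direct link distance $d_0$ has density $\frac{2r}{R_{\rm d}^2-1}$ on $[1,R_{\rm d}]$. - The interfering transmitters form a homogeneous PPP of density $\lambda$ on $\mathbb{R}^2$; $d_1,d_2,\dots$ denote their distances to the typical receiver. - Correlated fading: the direct fading vector ${\bf h}_0$ and the interfering fading vectors ${\bf h}_1,{\bf h}_2,\ldots$ in $\mathbb{C}^{N_{\rm r}}$ are ${\bf h}_\ell={\bf C}^{1/2}\tilde{\bf h}_\ell$, where ${\bf C}$ is a fixed (deterministic) symmetric positive semidefinite matrix, and $\tilde{\bf h}_0,\tilde{\bf h}_1,\dots$ are independent vectors with IID $\mathcal{CN}(0,1)$ entries (circularly symmetric complex Gaussian, $\mathbb{E}|\cdot|^2=1$). - $d_0$, the interferer point process, and the vectors $\tilde{\bf h}_\ell$ are mutually independent. Maximum ratio combining uses the receive vector ${\bf w}={\bf h}_0/\|{\bf h}_0\|_2$, giving $${\rm SINR}^{\rm mrc}=\frac{H_0\,d_0^{-\alpha}}{I+\frac{1}{\rm SNR}},\qquad H_0=\|{\bf h}_0\|_2^2,\qquad I=\sum_{\ell\ge1}H_\ell\, d_\ell^{-\alpha},\qquad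 H_\ell=\frac{|{\bf h}_0^*{\bf h}_\ell|^2}{\|{\bf h}_0\|_2^2}.$$ Here $\alpha$ is the path-loss exponent and ${\rm SNR}=P/\sigma^2$. *)

theory Defs
  imports "HOL-Probability.Probability" "HOL-Computational_Algebra.Polynomial"
begin

definition nsinc :: "real \<Rightarrow> real" where
  "nsinc x = sin (pi * x) / (pi * x)"

definition psd_matrix :: "real^'n^'n \<Rightarrow> bool" where
  "psd_matrix A \<longleftrightarrow> transpose A = A \<and> (\<forall>v. 0 \<le> v \<bullet> (A *v v))"

text \<open>The positive semidefinite square root is unique, so this relation determines \<open>S\<close> from \<open>C\<close>.\<close>

definition is_psd_sqrt :: "real^'n^'n \<Rightarrow> real^'n^'n \<Rightarrow> bool" where
  "is_psd_sqrt S C \<longleftrightarrow> psd_matrix S \<and> S ** S = C"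

text \<open>\<open>order x (charpoly A)\<close> is the algebraic multiplicity of \<open>x\<close> as an eigenvalue of \<open>A\<close>
  (zero if \<open>x\<close> is not an eigenvalue).\<close>

definition charpoly :: "real^'n^'n \<Rightarrow> real poly" where
  "charpoly A = det (\<chi> i j. (if i = j then [:0, 1:] else 0) - [:A $ i $ j:])"

definition complex_matrix :: "real^'n^'m \<Rightarrow> complex^'n^'m" where
  "complex_matrix A = (\<chi> i j. complex_of_real (A $ i $ j))"

definition herm_prod :: "complex^'n \<Rightarrow> complex^'n \<Rightarrow> complex" where
  "herm_prod u v = (\<Sum>i\<in>UNIV. cnj (u $ i) * v $ i)"

definition std_complex_normal_density :: "complex \<Rightarrow> real" where
  "std_complex_normal_density z = exp (- (cmod z)\<^sup>2) / pi"

definition annulus_distance_density :: "real \<Rightarrow> real \<Rightarrow> real" where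
  "annulus_distance_density R r = indicator {1..R} r * (2 * r / (R\<^sup>2 - 1))"

text \<open>A point process is represented by a measurable enumeration \<open>X 0, X 1, \<dots>\<close> of its points;
  the number of points in \<open>B\<close> is taken in \<^typ>\<open>ennreal\<close> so that infinite counts are visible.\<close>

definition point_count :: "(nat \<Rightarrow> 'w \<Rightarrow> 'a) \<Rightarrow> 'a set \<Rightarrow> 'w \<Rightarrow> ennreal" where
  "point_count X B \<omega> = (\<Sum>l. indicator B (X l \<omega>))"

definition homogeneous_PPP ::
    "'w measure \<Rightarrow> real \<Rightarrow> (nat \<Rightarrow> 'w \<Rightarrow> 'a::euclidean_space) \<Rightarrow> bool" where
  "homogeneous_PPP M lam X \<longleftrightarrow>
     (\<forall>l. X l \<in> borel_measurable M) \<and>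
     (\<forall>B \<in> sets borel. bounded B \<longrightarrow> (\<forall>k::nat.
        measure M {\<omega> \<in> space M. point_count X B \<omega> = of_nat k} =
          (lam * measure lborel B) ^ k / fact k * exp (- (lam * measure lborel B)))) \<and>
     (\<forall>(n::nat) B. (\<forall>i<n. B i \<in> sets borel \<and> bounded (B i)) \<and> disjoint_family_on B {..<n} \<longrightarrow>
        prob_space.indep_vars M (\<lambda>_. borel) (\<lambda>i. point_count X (B i)) {..<n})"

datatype source = Direct_Distance | Interferers | Fading nat

text \<open>The sigma algebra of \<open>Interferers\<close> is generated by the whole enumeration, so that the
  fading vectors are independent marks of the points.\<close>

primrec source_algebra ::
    "'w measure \<Rightarrow> ('w \<Rightarrow> real) \<Rightarrow> (nat \<Rightarrow> 'w \<Rightarrow> real^2) \<Rightarrow> (nat \<Rightarrow> 'w \<Rightarrow> complex^'n) \<Rightarrow>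
      source \<Rightarrow> 'w measure" where
  "source_algebra M d0 X g Direct_Distance = vimage_algebra (space M) d0 borel"
| "source_algebra M d0 X g Interferers =
     vimage_algebra (space M) (\<lambda>\<omega> l. X l \<omega>) (\<Pi>\<^sub>M l\<in>(UNIV :: nat set). borel)"
| "source_algebra M d0 X g (Fading l) = vimage_algebra (space M) (g l) borel"

text \<open>\<open>S\<close> plays the role of the square root of the correlation matrix and \<open>g l\<close> that of the
  uncorrelated fading vector; index \<open>0\<close> is the direct link.\<close>

definition fading :: "real^'n^'n \<Rightarrow> (nat \<Rightarrow> 'w \<Rightarrow> complex^'n) \<Rightarrow> nat \<Rightarrow> 'w \<Rightarrow> complex^'n" where
  "fading S g l \<omega> = complex_matrix S *v g l \<omega>"

definition signal_gain :: "real^'n^'n \<Rightarrow> (nat \<Rightarrow> 'w \<Rightarrow> complex^'n) \<Rightarrow> 'w \<Rightarrow> real" where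
  "signal_gain S g \<omega> = (norm (fading S g 0 \<omega>))\<^sup>2"

definition interferer_gain :: "real^'n^'n \<Rightarrow> (nat \<Rightarrow> 'w \<Rightarrow> complex^'n) \<Rightarrow> nat \<Rightarrow> 'w \<Rightarrow> real" where
  "interferer_gain S g l \<omega> =
     (cmod (herm_prod (fading S g 0 \<omega>) (fading S g l \<omega>)))\<^sup>2 / (norm (fading S g 0 \<omega>))\<^sup>2"

text \<open>The typical receiver is at the origin. The point \<open>X l\<close> is the interferer number \<open>Suc l\<close>.
  For path-loss exponents above 2 the series converges almost surely.\<close>

definition interference ::
    "real \<Rightarrow> real^'n^'n \<Rightarrow> (nat \<Rightarrow> 'w \<Rightarrow> real^2) \<Rightarrow> (nat \<Rightarrow> 'w \<Rightarrow> complex^'n) \<Rightarrow> 'w \<Rightarrow> real" where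
  "interference alpha S X g \<omega> =
     (\<Sum>l. interferer_gain S g (Suc l) \<omega> * norm (X l \<omega>) powr (- alpha))"

definition SINR_mrc ::
    "real \<Rightarrow> real \<Rightarrow> real^'n^'n \<Rightarrow> ('w \<Rightarrow> real) \<Rightarrow> (nat \<Rightarrow> 'w \<Rightarrow> real^2) \<Rightarrow>
      (nat \<Rightarrow> 'w \<Rightarrow> complex^'n) \<Rightarrow> 'w \<Rightarrow> real" where
  "SINR_mrc alpha SNR S d0 X g \<omega> =
     signal_gain S g \<omega> * d0 \<omega> powr (- alpha) / (interference alpha S X g \<omega> + 1 / SNR)"

definition sum_spectral_efficiency_mrc ::
    "'w measure \<Rightarrow> real \<Rightarrow> real \<Rightarrow> real \<Rightarrow> real^'n^'n \<Rightarrow> ('w \<Rightarrow> real) \<Rightarrow> (nat \<Rightarrow> 'w \<Rightarrow> real^2) \<Rightarrow>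
      (nat \<Rightarrow> 'w \<Rightarrow> complex^'n) \<Rightarrow> real" where
  "sum_spectral_efficiency_mrc M lam alpha SNR S d0 X g =
     lam * (\<integral>\<omega>. log 2 (1 + SINR_mrc alpha SNR S d0 X g \<omega>) \<partial>M)"

end

theory Submission
  imports Defs "HOL-Real_Asymp.Real_Asymp"
begin

text \<open>
  The starting point is \<open>ln (1 + a / b) = \<integral> (1 - exp (- z a)) exp (- z b) / z dz\<close> over \<open>z > 0\<close>, applied
  to \<open>a = H\<^sub>0 d\<^sub>0 powr - \<alpha>\<close> and \<open>b = I + 1 / SNR\<close>. In an orthonormal eigenbasis of \<open>C\<close> the Laplace
  transform of \<open>H\<^sub>0\<close> is the product of the factors \<open>1 / (1 + \<mu>\<^sub>n s)\<close>. Given the direct fading \<open>h\<^sub>0\<close>, each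
  interferer gain is exponential with mean \<open>|C\<^sup>1\<^sup>/\<^sup>2 h\<^sub>0|\<^sup>2 / |h\<^sub>0|\<^sup>2 \<le> \<mu>\<^sub>1\<close>, so replacing the mean by \<open>\<mu>\<^sub>1\<close> only
  decreases the conditional Laplace transform of \<open>I\<close>. The result no longer depends on the direct link and
  is the Laplace functional of a Poisson process, which is evaluated by a Beta integral. Replacing
  the mean is the only inequality. As \<open>exp (- z I)\<close> decreases in the number of interferers, the lower
  bound may be proved for finitely many of them; letting \<open>z\<close> tend to \<open>0\<close> it also yields the almost sure convergence
  of the interference series.
\<close>

subsection \<open>An integral formula for the logarithm\<close>

text \<open>The direct fading enters the signal and every interferer gain, so the signal and the
  interference are dependent and the expectation of \<open>1 - exp (- z a)\<close> times
  \<open>exp (- z I)\<close> does not factor. Only a bound on the conditional Laplace transform of I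
  that is uniform in the direct link makes it factor. Conditional expectations are avoided: by
  independence, one block of sources is frozen and another is averaged over a fresh sample point.
  The interferers are known only through independent Poisson counts on bounded sets, so their
  Laplace functional is reached through step functions of bounded support. Estimates are kept in
  \<open>ennreal\<close>. A Bochner integral that does not exist is 0; this is harmless for the
  lower bound but not for the expectation, whose finiteness has to be proved. It rests on d0 >= 1,
  which makes the mean of \<open>1 - exp (- z a)\<close> of order z and cancels the factor 1 /
  z.\<close>

lemma nn_integral_exp_Ioi:
  fixes b :: real
  assumes "b > 0"
  shows "(\<integral>\<^sup>+z. ennreal (exp (- (z * b))) * indicator {0<..} z \<partial>lborel) = ennreal (1 / b)"
proof -
  have "(\<integral>\<^sup>+z. ennreal (exp (- (z * b))) * indicator {0..} z \<partial>lborel)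
      = ennreal (0 - (- (exp (- (0 * b)) / b)))"
  proof (rule nn_integral_FTC_atLeast)
    show "((\<lambda>z. - (exp (- (z * b)) / b)) \<longlongrightarrow> 0) at_top"
      using assms by real_asymp
    fix x :: real
    show "DERIV (\<lambda>z. - (exp (- (z * b)) / b)) x :> exp (- (x * b))"
      using assms by (auto intro!: derivative_eq_intros)
  qed auto
  also have "(\<integral>\<^sup>+z. ennreal (exp (- (z * b))) * indicator {0..} z \<partial>lborel)
      = (\<integral>\<^sup>+z. ennreal (exp (- (z * b))) * indicator {0<..} z \<partial>lborel)"
    by (intro nn_integral_cong_AE, rule AE_mp[OF AE_lborel_singleton[of 0]])
       (auto simp: indicator_def)
  finally show ?thesis by simp
qed

lemma nn_integral_exp_Icc:
  fixes a z :: real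
  assumes "a \<ge> 0" "z > 0"
  shows "(\<integral>\<^sup>+t. ennreal (exp (- (z * t))) * indicator {0..a} t \<partial>lborel)
    = ennreal ((1 - exp (- (z * a))) / z)"
proof -
  have "(\<integral>\<^sup>+t. ennreal (exp (- (z * t))) * indicator {0..a} t \<partial>lborel)
      = ennreal ((- (exp (- (z * a)) / z)) - (- (exp (- (z * 0)) / z)))"
    by (rule nn_integral_FTC_Icc) (use assms in \<open>auto intro!: derivative_eq_intros\<close>)
  also have "(- (exp (- (z * a)) / z)) - (- (exp (- (z * 0)) / z)) = (1 - exp (- (z * a))) / z"
    using assms by (simp add: diff_divide_distrib)
  finally show ?thesis .
qed

lemma nn_integral_inverse_Icc:
  fixes a b :: real
  assumes "a \<ge> 0" "b > 0"
  shows "(\<integral>\<^sup>+t. ennreal (1 / (t + b)) * indicator {0..a} t \<partial>lborel) = ennreal (ln (1 + a / b))"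
proof -
  have "(\<integral>\<^sup>+t. ennreal (1 / (t + b)) * indicator {0..a} t \<partial>lborel)
      = ennreal (ln (a + b) - ln (0 + b))"
    by (rule nn_integral_FTC_Icc) (use assms in \<open>auto intro!: derivative_eq_intros simp: divide_simps\<close>)
  also have "ln (a + b) - ln (0 + b) = ln (1 + a / b)"
    using assms by (subst ln_divide_pos[symmetric]) (auto simp: add_divide_distrib add.commute)
  finally show ?thesis .
qed

text \<open>An integral of Frullani type: (1 - exp (- z a)) / z is the integral of exp (- z t) over
  t in [0, a]. Exchanging the two integrals by Tonelli leaves the integral of 1 / (t + b) over
  [0, a].\<close>

lemma nn_integral_ln_one_plus:
  fixes a b :: real
  assumes a: "a \<ge> 0" and b: "b > 0"
  shows "(\<integral>\<^sup>+z. ennreal ((1 - exp (- (z * a))) * exp (- (z * b)) / z) * indicator {0<..} z \<partial>lborel)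
    = ennreal (ln (1 + a / b))"
proof -
  have "(\<integral>\<^sup>+z. ennreal ((1 - exp (- (z * a))) * exp (- (z * b)) / z) * indicator {0<..} z \<partial>lborel)
    = (\<integral>\<^sup>+z. (\<integral>\<^sup>+t. (ennreal (exp (- (z * (t + b)))) * indicator {0<..} z) * indicator {0..a} t \<partial>lborel) \<partial>lborel)"
  proof (rule nn_integral_cong)
    fix z :: real
    show "ennreal ((1 - exp (- (z * a))) * exp (- (z * b)) / z) * indicator {0<..} z
      = (\<integral>\<^sup>+t. (ennreal (exp (- (z * (t + b)))) * indicator {0<..} z) * indicator {0..a} t \<partial>lborel)"
    proof (cases "z > 0")
      case True
      have "(\<integral>\<^sup>+t. (ennreal (exp (- (z * (t + b)))) * indicator {0<..} z) * indicator {0..a} t \<partial>lborel)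
        = (\<integral>\<^sup>+t. ennreal (exp (- (z * b))) * (ennreal (exp (- (z * t))) * indicator {0..a} t) \<partial>lborel)"
        using True by (intro nn_integral_cong)
          (auto simp: indicator_def ennreal_mult[symmetric] exp_add[symmetric] algebra_simps)
      also have "\<dots> = ennreal (exp (- (z * b))) * ennreal ((1 - exp (- (z * a))) / z)"
        using nn_integral_exp_Icc[OF a True] by (subst nn_integral_cmult) auto
      also have "\<dots> = ennreal ((1 - exp (- (z * a))) * exp (- (z * b)) / z)"
        using True a by (subst ennreal_mult[symmetric]) (auto simp: mult_ac)
      finally show ?thesis using True by simp
    qed auto
  qed
  also have "\<dots> = (\<integral>\<^sup>+t. (\<integral>\<^sup>+z. (ennreal (exp (- (z * (t + b)))) * indicator {0<..} z) * indicator {0..a} t \<partial>lborel) \<partial>lborel)"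
    by (rule lborel_pair.Fubini') measurable
  also have "\<dots> = (\<integral>\<^sup>+t. ennreal (1 / (t + b)) * indicator {0..a} t \<partial>lborel)"
  proof (rule nn_integral_cong)
    fix t :: real
    show "(\<integral>\<^sup>+z. (ennreal (exp (- (z * (t + b)))) * indicator {0<..} z) * indicator {0..a} t \<partial>lborel)
      = ennreal (1 / (t + b)) * indicator {0..a} t"
      using b nn_integral_exp_Ioi[of "t + b"]
      by (cases "t \<in> {0..a}") (auto simp: add_nonneg_pos)
  qed
  also have "\<dots> = ennreal (ln (1 + a / b))"
    by (rule nn_integral_inverse_Icc[OF a b])
  finally show ?thesis .
qed

subsection \<open>Diagonalization of symmetric matrices\<close>

text \<open>A maximizer v of the quadratic form on the unit sphere of V is an eigenvector. The form
  m |w|^2 - w . f w is nonnegative on V and vanishes at v; moving from v along the defect u = m v -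
  f v changes it at first order by 2 t |u|^2, which must not become negative for small t <
  0.\<close>

lemma selfadjoint_eigenvector_exists:
  fixes f :: "'a::euclidean_space \<Rightarrow> 'a"
  assumes f: "linear f" and sa: "\<And>x y. f x \<bullet> y = x \<bullet> f y"
    and V: "subspace V" "f ` V \<subseteq> V" "V \<noteq> {0}"
  obtains v m where "v \<in> V" "norm v = 1" "f v = m *\<^sub>R v"
proof -
  let ?K = "V \<inter> sphere 0 1"
  have "compact ?K"
    by (metis V(1) closed_subspace compact_Int_closed compact_sphere inf_commute)
  moreover have "?K \<noteq> {}"
  proof -
    obtain w where w: "w \<in> V" "w \<noteq> 0" using V subspace_0 by blast
    then have "w /\<^sub>R norm w \<in> ?K" using V(1) by (auto simp: subspace_scale)
    then show ?thesis by blast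
  qed
  moreover have "continuous_on ?K (\<lambda>x. x \<bullet> f x)"
    using f by (intro continuous_intros linear_continuous_on) (simp add: linear_conv_bounded_linear)
  ultimately obtain v where v: "v \<in> ?K" and max: "\<And>x. x \<in> ?K \<Longrightarrow> x \<bullet> f x \<le> v \<bullet> f v"
    using continuous_attains_sup[of ?K "\<lambda>x. x \<bullet> f x"] by blast
  define m where "m = v \<bullet> f v"
  have vv: "v \<bullet> v = 1" using v by (simp add: dot_square_norm)
  have nonneg: "0 \<le> m * (w \<bullet> w) - w \<bullet> f w" if "w \<in> V" for w
  proof (cases "w = 0")
    case True then show ?thesis by simp
  next
    case False
    have "w /\<^sub>R norm w \<in> ?K" using that False V(1) by (auto simp: subspace_scale)
    from max[OF this] have "(w \<bullet> f w) / (norm w)\<^sup>2 \<le> m"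
      using f by (simp add: linear_cmul m_def power2_eq_square field_simps)
    then show ?thesis using False by (simp add: dot_square_norm field_simps)
  qed
  define u where "u = m *\<^sub>R v - f v"
  have uV: "u \<in> V" unfolding u_def using v V by (auto intro!: subspace_diff subspace_scale)
  have "u \<bullet> u = 0"
  proof (rule ccontr)
    assume "u \<bullet> u \<noteq> 0"
    then have pos: "u \<bullet> u > 0" using inner_gt_zero_iff by force
    define G where "G = m * (u \<bullet> u) - u \<bullet> f u"
    have G: "G \<ge> 0" unfolding G_def using nonneg[OF uV] .
    have *: "0 \<le> 2 * t * (u \<bullet> u) + t\<^sup>2 * G" for t
    proof -
      have "v + t *\<^sub>R u \<in> V" using v uV V(1) by (auto intro!: subspace_add subspace_scale)
      from nonneg[OF this]
      have "0 \<le> m * ((v + t *\<^sub>R u) \<bullet> (v + t *\<^sub>R u)) - (v + t *\<^sub>R u) \<bullet> (f v + t *\<^sub>R f u)"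
        using f by (simp add: linear_add linear_cmul)
      also have "\<dots> = 2 * t * (m * (v \<bullet> u) - f v \<bullet> u) + t\<^sup>2 * G"
        using sa[of v u] vv
        by (simp add: inner_add_left inner_add_right algebra_simps G_def inner_commute m_def
            power2_eq_square)
      also have "m * (v \<bullet> u) - f v \<bullet> u = u \<bullet> u"
        by (simp add: u_def inner_diff_left)
      finally show ?thesis .
    qed
    \<comment> \<open>The quadratic in t would be minimal at - |u|^2 / G; the 1 in the denominator
      covers G = 0 and still leaves a negative value.\<close>
    define t where "t = - (u \<bullet> u) / (G + 1)"
    have "2 * t * (u \<bullet> u) + t\<^sup>2 * G = (u \<bullet> u)\<^sup>2 / (G + 1) * (G / (G + 1) - 2)"
      using G by (simp add: t_def power2_eq_square divide_simps) (simp add: algebra_simps)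
    moreover have "G / (G + 1) < 2" using G by (simp add: divide_simps)
    ultimately have "2 * t * (u \<bullet> u) + t\<^sup>2 * G < 0"
      using pos G by (smt (verit) divide_pos_pos mult_pos_neg zero_less_power)
    with *[of t] show False by simp
  qed
  then have "f v = m *\<^sub>R v" by (simp add: u_def)
  then show ?thesis using that v by auto
qed

text \<open>Stated for invariant subspaces so that induction on the dimension can pass to the
  orthogonal complement of an eigenvector, which is invariant because f is self-adjoint.\<close>

lemma selfadjoint_orthonormal_eigenbasis:
  fixes f :: "'a::euclidean_space \<Rightarrow> 'a"
  assumes f: "linear f" and sa: "\<And>x y. f x \<bullet> y = x \<bullet> f y"
    and V: "subspace V" "f ` V \<subseteq> V"
  shows "\<exists>B. B \<subseteq> V \<and> pairwise orthogonal B \<and> (\<forall>b\<in>B. norm b = 1) \<and> span B = V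
    \<and> (\<forall>b\<in>B. \<exists>d. f b = d *\<^sub>R b)"
  using V
proof (induction "dim V" arbitrary: V rule: less_induct)
  case less
  show ?case
  proof (cases "V = {0}")
    case True
    then show ?thesis by (intro exI[of _ "{}"]) auto
  next
    case False
    from selfadjoint_eigenvector_exists[OF f sa less.prems False]
    obtain v m where v: "v \<in> V" "norm v = 1" "f v = m *\<^sub>R v" by blast
    define V' where "V' = V \<inter> {x. v \<bullet> x = 0}"
    have sub: "subspace V'" unfolding V'_def
      using less.prems(1) by (intro subspace_inter subspace_hyperplane)
    have vv: "v \<bullet> v = 1" using v by (simp add: dot_square_norm)
    have "dim V' < dim V"
    proof (rule dim_psubset)
      have *: "span V' = V'" "span V = V" using sub less.prems(1) by (simp_all add: span_eq_iff)
      have "v \<notin> V'" "V' \<subseteq> V" using vv by (auto simp: V'_def)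
      then show "span V' \<subset> span V" unfolding * using v(1) by blast
    qed
    moreover have "f ` V' \<subseteq> V'"
      using less.prems(2) sa[of v] v(3) by (auto simp: V'_def) (metis inner_scaleR_left mult_zero_right)
    ultimately obtain B where B: "B \<subseteq> V'" "pairwise orthogonal B" "\<forall>b\<in>B. norm b = 1"
      "span B = V'" "\<forall>b\<in>B. \<exists>d. f b = d *\<^sub>R b"
      using less.hyps[OF _ sub] by blast
    have orth: "b \<in> B \<Longrightarrow> orthogonal v b" for b using B(1) by (auto simp: V'_def orthogonal_def)
    have "span (insert v B) = V"
    proof
      show "span (insert v B) \<subseteq> V"
        using B(1) v(1) less.prems(1) by (intro span_minimal) (auto simp: V'_def)
      show "V \<subseteq> span (insert v B)"
      proof
        fix x assume x: "x \<in> V"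
        have "x - (v \<bullet> x) *\<^sub>R v \<in> V'" unfolding V'_def
          using x v(1) less.prems(1) vv by (auto simp: inner_diff_right intro!: subspace_diff subspace_scale)
        then have "x - (v \<bullet> x) *\<^sub>R v \<in> span B" using B(4) by simp
        then show "x \<in> span (insert v B)" unfolding span_insert by blast
      qed
    qed
    then show ?thesis using B v orth
      by (intro exI[of _ "insert v B"])
        (auto simp: pairwise_insert V'_def orthogonal_commute simp del: span_insert)
  qed
qed

text \<open>The eigenbasis arises as a set; being an independent spanning set it has as many
  elements as the index type, so it can be indexed by \<open>'n\<close> and the eigenvalues become a
  function that repeats them with multiplicity.\<close>

lemma symmetric_matrix_diagonalization:
  fixes A :: "real^'n^'n"
  assumes "transpose A = A"
  obtains Q :: "'n \<Rightarrow> real^'n" and d where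
    "\<And>i j. Q i \<bullet> Q j = (if i = j then 1 else 0)" "\<And>i. A *v Q i = d i *\<^sub>R Q i"
proof -
  have sa: "(A *v x) \<bullet> y = x \<bullet> (A *v y)" for x y
    using dot_lmul_matrix[of x A y] assms by (metis transpose_matrix_vector)
  obtain B where B: "pairwise orthogonal B" "\<forall>b\<in>B. norm b = 1" "span B = UNIV"
      "\<forall>b\<in>B. \<exists>d. A *v b = d *\<^sub>R b"
    using selfadjoint_orthonormal_eigenbasis[of "(*v) A" UNIV] sa by auto
  have "independent B"
    using B by (intro pairwise_orthogonal_independent) auto
  then have "finite B" "card B = CARD('n)"
    using B(3) by (auto simp: independent_imp_finite dim_span_eq_card_independent[symmetric])
  then obtain Q where Q: "bij_betw Q (UNIV :: 'n set) B"
    by (metis finite_same_card_bij finite_class.finite_UNIV)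
  have inB: "Q i \<in> B" for i using Q by (auto simp: bij_betw_def)
  have inj: "Q i = Q j \<longleftrightarrow> i = j" for i j using Q by (auto simp: bij_betw_def inj_on_def)
  show ?thesis
  proof
    show "Q i \<bullet> Q j = (if i = j then 1 else 0)" for i j
      using B(1,2) inB[of i] inB[of j] inj[of i j]
      by (auto simp: pairwise_def orthogonal_def dot_square_norm)
    show "A *v Q i = (SOME d. A *v Q i = d *\<^sub>R Q i) *\<^sub>R Q i" for i
      using B(4) inB[of i] by (metis (mono_tags, lifting) someI_ex)
  qed
qed

section \<open>Characteristic polynomial and multiplicities of eigenvalues\<close>

lemma poly_det:
  fixes P :: "'a::comm_ring_1 poly^'n^'n"
  shows "poly (det P) x = det (\<chi> i j. poly (P $ i $ j) x)"
  by (simp add: det_def poly_sum poly_prod poly_mult)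

text \<open>A real polynomial is determined by its values, so it suffices to evaluate at each x.
  There \<open>charpoly\<close> is the determinant of an ordinary matrix, which conjugation by the
  orthogonal matrix with rows Q i makes diagonal.\<close>

lemma charpoly_eq_prod:
  fixes A :: "real^'n^'n" and Q :: "'n \<Rightarrow> real^'n"
  assumes Q: "\<And>i j. Q i \<bullet> Q j = (if i = j then 1 else 0)" and A: "\<And>i. A *v Q i = d i *\<^sub>R Q i"
  shows "charpoly A = (\<Prod>i\<in>UNIV. [:- d i, 1:])"
proof -
  have "poly (charpoly A) x = poly (\<Prod>i\<in>UNIV. [:- d i, 1:]) x" for x
  proof -
    define U :: "real^'n^'n" where "U = (\<chi> i. Q i)"
    have U: "U ** transpose U = mat 1"
      using Q by (simp add: vec_eq_iff U_def matrix_matrix_mult_def transpose_def mat_def inner_vec_def)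
    have "poly (charpoly A) x = det (mat x - A)"
      unfolding charpoly_def poly_det
      by (intro arg_cong[where f=det]) (auto simp: vec_eq_iff mat_def)
    also have "\<dots> = det U * det (mat x - A) * det (transpose U)"
      using arg_cong[OF U, of det] by (simp add: det_mul)
    also have "\<dots> = det (U ** ((mat x - A) ** transpose U))"
      by (simp add: det_mul)
    also have "U ** ((mat x - A) ** transpose U) = (\<chi> i j. if i = j then x - d j else 0)"
    proof -
      have col: "column j ((mat x - A) ** transpose U) = (x - d j) *\<^sub>R Q j" for j
      proof -
        have "column j ((mat x - A) ** transpose U) = (mat x - A) *v column j (transpose U)"
          by (simp add: vec_eq_iff column_def matrix_matrix_mult_def matrix_vector_mult_def)
        also have "column j (transpose U) = Q j"
          by (simp add: vec_eq_iff column_def transpose_def U_def)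
        also have "(mat x - A) *v Q j = mat x *v Q j - A *v Q j"
          by (simp add: matrix_vector_mult_diff_rdistrib)
        also have "mat x *v Q j = x *\<^sub>R Q j"
          by (simp add: vec_eq_iff matrix_vector_mult_def mat_def if_distrib[where f="\<lambda>y. y * _"] cong: if_cong)
        finally show ?thesis by (simp add: A scaleR_left_diff_distrib)
      qed
      have "(U ** ((mat x - A) ** transpose U)) $ i $ j = Q i \<bullet> column j ((mat x - A) ** transpose U)" for i j
        by (simp add: U_def matrix_matrix_mult_def column_def inner_vec_def)
      then show ?thesis by (simp add: vec_eq_iff col Q)
    qed
    also have "det \<dots> = (\<Prod>i\<in>UNIV. x - d i)"
      by (subst det_diagonal) auto
    finally show ?thesis by (simp add: poly_prod)
  qed
  then show ?thesis by (simp add: poly_eq_poly_eq_iff[symmetric] fun_eq_iff)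
qed

lemma order_linear: "order x [:- a, 1:] = (if x = (a::'a::idom) then 1 else 0)"
  using order_power_n_n[of a 1] by (auto simp: order_0I)

lemma order_prod_linear:
  fixes d :: "'i \<Rightarrow> 'a::idom"
  assumes "finite I"
  shows "order x (\<Prod>i\<in>I. [:- d i, 1:]) = card {i\<in>I. d i = x}"
  using assms
proof (induction I rule: finite_induct)
  case empty then show ?case by simp
next
  case (insert j I)
  have "{i \<in> insert j I. d i = x} = (if d j = x then insert j {i\<in>I. d i = x} else {i\<in>I. d i = x})"
    by auto
  moreover have "(\<Prod>i\<in>I. [:- d i, 1:]) \<noteq> 0" using insert by (simp add: prod_zero_iff)
  ultimately show ?case using insert
    by (simp add: order_mult order_linear del: mult_pCons_left)
qed

text \<open>Intended for z = 0 and F x = 1 / (1 + s x): it turns a product over all eigenvalues,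
  zeros included, into one over the list of positive eigenvalues, since the value z contributes
  factors 1 only.\<close>

lemma prod_eq_if_card_eq:
  fixes f :: "'a \<Rightarrow> 'c" and h :: "'b \<Rightarrow> 'c" and F :: "'c \<Rightarrow> 'd::comm_monoid_mult"
  assumes fin: "finite A" "finite B"
    and card: "\<And>x. x \<noteq> z \<Longrightarrow> card {a\<in>A. f a = x} = card {b\<in>B. h b = x}"
    and F: "F z = 1"
  shows "(\<Prod>a\<in>A. F (f a)) = (\<Prod>b\<in>B. F (h b))"
proof -
  define R where "R = f ` A \<union> h ` B"
  have R: "finite R" using fin by (simp add: R_def)
  have "(\<Prod>a\<in>A. F (f a)) = (\<Prod>x\<in>R. \<Prod>a\<in>{a\<in>A. f a = x}. F (f a))"
    by (rule prod.group[symmetric]) (use fin R in \<open>auto simp: R_def\<close>)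
  also have "\<dots> = (\<Prod>x\<in>R. F x ^ card {a\<in>A. f a = x})"
    by (intro prod.cong) auto
  also have "\<dots> = (\<Prod>x\<in>R. F x ^ card {b\<in>B. h b = x})"
  proof (rule prod.cong)
    show "F x ^ card {a\<in>A. f a = x} = F x ^ card {b\<in>B. h b = x}" for x
      using card[of x] F by (cases "x = z") auto
  qed simp
  also have "\<dots> = (\<Prod>x\<in>R. \<Prod>b\<in>{b\<in>B. h b = x}. F (h b))"
    by (intro prod.cong) auto
  also have "\<dots> = (\<Prod>b\<in>B. F (h b))"
    by (rule prod.group) (use fin R in \<open>auto simp: R_def\<close>)
  finally show ?thesis .
qed

subsection \<open>Quadratic forms of complex Gaussian vectors\<close>

text \<open>The centred normal law of variance 1/2, which is the law of the real and of the
  imaginary part of a standard complex normal variable. It is not the law of the modulus of a normal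
  variable, which has the same name.\<close>

definition half_normal :: "real measure" where
  "half_normal = density lborel (\<lambda>y. ennreal (normal_density 0 (1 / sqrt 2) y))"

lemma prob_space_half_normal: "prob_space half_normal"
  unfolding half_normal_def by (rule prob_space_normal_density) simp

lemma space_half_normal [simp]: "space half_normal = UNIV"
  and sets_half_normal [measurable_cong, simp]: "sets half_normal = sets borel"
  by (simp_all add: half_normal_def)

lemma half_normal_density: "normal_density 0 (1 / sqrt 2) y = exp (- y\<^sup>2) / sqrt pi"
  by (simp add: normal_density_def power_divide)

text \<open>With variance 1/2, evaluating the characteristic function at 2 t gives exp (- t^2)
  without constants; hence the factor 2 in all exponents below.\<close>

lemma half_normal_char:
  "(CLINT y|half_normal. iexp (2 * (t * y))) = complex_of_real (exp (- t\<^sup>2))"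
proof -
  have "(CLINT y|half_normal. iexp (2 * (t * y)))
      = (CLBINT y. normal_density 0 (1 / sqrt 2) y *\<^sub>R iexp (2 * (t * y)))"
    unfolding half_normal_def by (subst integral_density) auto
  also have "\<dots> = \<bar>1 / sqrt 2\<bar> *\<^sub>R (CLBINT s. normal_density 0 (1 / sqrt 2) (0 + 1 / sqrt 2 * s) *\<^sub>R
      iexp (2 * (t * (0 + 1 / sqrt 2 * s))))"
    by (rule lborel_integral_real_affine) simp
  also have "\<dots> = (CLBINT s. \<bar>1 / sqrt 2\<bar> *\<^sub>R (normal_density 0 (1 / sqrt 2) (0 + 1 / sqrt 2 * s) *\<^sub>R
      iexp (2 * (t * (0 + 1 / sqrt 2 * s)))))"
    by (rule integral_scaleR_right[symmetric])
  also have "\<dots> = (CLBINT s. std_normal_density s *\<^sub>R iexp (sqrt 2 * t * s))"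
  proof (rule Bochner_Integration.integral_cong)
    fix s :: real
    have "2 * (t * (0 + 1 / sqrt 2 * s)) = sqrt 2 * t * s"
      by (simp add: field_simps)
    moreover have "\<bar>1 / sqrt 2\<bar> * normal_density 0 (1 / sqrt 2) (0 + 1 / sqrt 2 * s) = std_normal_density s"
      by (simp add: normal_density_def power_divide power_mult_distrib real_sqrt_mult)
    ultimately show "\<bar>1 / sqrt 2\<bar> *\<^sub>R (normal_density 0 (1 / sqrt 2) (0 + 1 / sqrt 2 * s) *\<^sub>R
        iexp (2 * (t * (0 + 1 / sqrt 2 * s)))) = std_normal_density s *\<^sub>R iexp (sqrt 2 * t * s)"
      by simp
  qed simp
  also have "\<dots> = (CLINT s|std_normal_distribution. iexp (sqrt 2 * t * s))"
    by (subst integral_density) auto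
  also have "\<dots> = char std_normal_distribution (sqrt 2 * t)"
    by (simp add: char_def)
  also have "\<dots> = complex_of_real (exp (- t\<^sup>2))"
    by (simp add: char_std_normal_distribution power_mult_distrib)
  finally show ?thesis .
qed

text \<open>Up to the factor 1 / sqrt (1 + d), the weighted density is the normal density of
  variance 1 / (2 (1 + d)).\<close>

lemma half_normal_exp_square:
  assumes "d \<ge> 0"
  shows "(LINT y|half_normal. exp (- (d * y\<^sup>2))) = 1 / sqrt (1 + d)"
proof -
  have "(LINT y|half_normal. exp (- (d * y\<^sup>2)))
      = (LBINT y. normal_density 0 (1 / sqrt 2) y *\<^sub>R exp (- (d * y\<^sup>2)))"
    unfolding half_normal_def by (subst integral_density) auto
  also have "\<dots> = (LBINT y. 1 / sqrt (1 + d) * normal_density 0 (1 / sqrt (2 * (1 + d))) y)"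
  proof (intro Bochner_Integration.integral_cong refl)
    fix y :: real
    have "(1 / sqrt (2 * (1 + d)))\<^sup>2 = 1 / (2 * (1 + d))"
      using assms by (simp add: power_divide)
    then have "normal_density 0 (1 / sqrt (2 * (1 + d))) y
        = sqrt (1 + d) / sqrt pi * exp (- y\<^sup>2 + - (d * y\<^sup>2))"
    proof -
      assume *: "(1 / sqrt (2 * (1 + d)))\<^sup>2 = 1 / (2 * (1 + d))"
      have "2 * pi * (1 / (2 * (1 + d))) = pi / (1 + d)"
        "- (y - 0)\<^sup>2 / (2 * (1 / (2 * (1 + d)))) = - y\<^sup>2 + - (d * y\<^sup>2)"
        using assms by (simp_all add: field_simps)
      then show ?thesis
        unfolding normal_density_def * by (simp add: real_sqrt_divide)
    qed
    then show "normal_density 0 (1 / sqrt 2) y *\<^sub>R exp (- (d * y\<^sup>2))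
        = 1 / sqrt (1 + d) * normal_density 0 (1 / sqrt (2 * (1 + d))) y"
      using assms by (simp add: half_normal_density exp_add[symmetric])
  qed
  also have "\<dots> = 1 / sqrt (1 + d)"
    using assms by simp
  finally show ?thesis .
qed

section \<open>Characteristic function of the standard complex normal law\<close>

lemma borel_measurable_Complex [measurable]:
  "(\<lambda>p. Complex (fst p) (snd p)) \<in> borel_measurable (borel \<Otimes>\<^sub>M borel)"
  by (simp add: Complex_eq)

text \<open>Lebesgue measure is determined by its values on boxes. Needed to split the complex
  density into two real factors.\<close>

lemma lborel_complex: "lborel = distr (lborel \<Otimes>\<^sub>M lborel) borel (\<lambda>(x, y). Complex x y)"
proof (rule lborel_eqI)
  fix l u :: complex
  assume le_Basis: "\<And>b. b \<in> Basis \<Longrightarrow> l \<bullet> b \<le> u \<bullet> b"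
  have le: "Re l \<le> Re u" "Im l \<le> Im u"
    using le_Basis[of 1] le_Basis[of \<i>] by (auto simp: Basis_complex_def inner_complex_def)
  have "(\<lambda>(x, y). Complex x y) -` box l u \<inter> space (lborel \<Otimes>\<^sub>M lborel)
    = {Re l<..<Re u} \<times> {Im l<..<Im u}"
    by (auto simp: box_def Basis_complex_def inner_complex_def space_pair_measure)
  then show "emeasure (distr (lborel \<Otimes>\<^sub>M lborel) borel (\<lambda>(x, y). Complex x y)) (box l u)
      = ennreal (\<Prod>b\<in>Basis. (u - l) \<bullet> b)"
    using le by (subst emeasure_distr)
      (auto simp: lborel.emeasure_pair_measure_Times Basis_complex_def inner_complex_def
        ennreal_mult[symmetric] case_prod_beta')
qed simp

text \<open>The density exp (- |z|^2) / pi is the product of the \<open>half_normal\<close>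
  densities at Re z and Im z, and the real inner product of u and z is Re u Re z + Im u Im z, so the
  integral splits into two real characteristic functions.\<close>

lemma (in prob_space) std_complex_normal_char:
  fixes Z :: "'a \<Rightarrow> complex"
  assumes Z: "distributed M lborel Z (\<lambda>z. ennreal (std_complex_normal_density z))"
  shows "(CLINT \<omega>|M. iexp (2 * (u \<bullet> Z \<omega>))) = complex_of_real (exp (- (norm u)\<^sup>2))"
proof -
  interpret N: prob_space half_normal by (rule prob_space_half_normal)
  interpret NN: pair_prob_space half_normal half_normal ..
  let ?h = "\<lambda>z. iexp (2 * (u \<bullet> z))"
  have meas[measurable]: "std_complex_normal_density \<in> borel_measurable borel"
    unfolding std_complex_normal_density_def by measurable
  have Zm[measurable]: "Z \<in> borel_measurable M"
    using distributed_measurable[OF Z] by simp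
  have "(CLINT \<omega>|M. ?h (Z \<omega>)) = (CLINT z|distr M lborel Z. ?h z)"
    by (subst integral_distr) auto
  also have "\<dots> = (CLINT z|lborel. std_complex_normal_density z *\<^sub>R ?h z)"
    unfolding distributed_distr_eq_density[OF Z]
    by (subst integral_density) (auto simp: std_complex_normal_density_def)
  also have "\<dots> = (CLINT p|lborel \<Otimes>\<^sub>M lborel. std_complex_normal_density (Complex (fst p) (snd p)) *\<^sub>R
      ?h (Complex (fst p) (snd p)))"
    by (subst lborel_complex, subst integral_distr) (auto simp: case_prod_beta')
  also have "\<dots> = (CLINT p|lborel \<Otimes>\<^sub>M lborel.
      (normal_density 0 (1 / sqrt 2) (fst p) * normal_density 0 (1 / sqrt 2) (snd p)) *\<^sub>R
      ?h (Complex (fst p) (snd p)))"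
    by (intro Bochner_Integration.integral_cong refl)
      (simp add: half_normal_density std_complex_normal_density_def cmod_def exp_add[symmetric])
  also have "\<dots> = (CLINT p|half_normal \<Otimes>\<^sub>M half_normal. ?h (Complex (fst p) (snd p)))"
  proof -
    have "half_normal \<Otimes>\<^sub>M half_normal = density (lborel \<Otimes>\<^sub>M lborel) (\<lambda>p.
      ennreal (normal_density 0 (1 / sqrt 2) (fst p) * normal_density 0 (1 / sqrt 2) (snd p)))"
      unfolding half_normal_def
      by (subst pair_measure_density)
        (auto simp: ennreal_mult[symmetric] case_prod_beta' lborel.sigma_finite_measure_axioms
          intro!: prob_space_imp_sigma_finite prob_space_normal_density)
    then show ?thesis
      by (simp, subst integral_density) auto
  qed
  also have "\<dots> = (CLINT p|half_normal \<Otimes>\<^sub>M half_normal.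
      iexp (2 * (Re u * fst p)) * iexp (2 * (Im u * snd p)))"
    by (intro Bochner_Integration.integral_cong refl)
      (simp add: inner_complex_def exp_add[symmetric] algebra_simps)
  also have "\<dots> = (CLINT x|half_normal. CLINT y|half_normal.
      iexp (2 * (Re u * x)) * iexp (2 * (Im u * y)))"
    by (subst NN.integral_fst'[symmetric])
      (auto intro!: NN.P.integrable_const_bound[where B=1] simp: norm_mult)
  also have "\<dots> = complex_of_real (exp (- (Re u)\<^sup>2)) * complex_of_real (exp (- (Im u)\<^sup>2))"
    by (simp only: Bochner_Integration.integral_mult_right_zero
        Bochner_Integration.integral_mult_left_zero half_normal_char)
  also have "\<dots> = complex_of_real (exp (- (norm u)\<^sup>2))"
    by (simp add: cmod_def of_real_mult[symmetric] exp_add[symmetric] del: of_real_mult)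
  finally show ?thesis .
qed

lemma (in prob_space) std_complex_normal_vector_char:
  fixes g :: "'a \<Rightarrow> complex^'n"
  assumes indep: "indep_vars (\<lambda>_. borel) (\<lambda>i \<omega>. g \<omega> $ i) UNIV"
    and normal: "\<And>i. distributed M lborel (\<lambda>\<omega>. g \<omega> $ i)
                   (\<lambda>z. ennreal (std_complex_normal_density z))"
  shows "(CLINT \<omega>|M. iexp (2 * (w \<bullet> g \<omega>))) = complex_of_real (exp (- (norm w)\<^sup>2))"
proof -
  have [measurable]: "(\<lambda>\<omega>. g \<omega> $ i) \<in> borel_measurable M" for i
    using distributed_measurable[OF normal[of i]] by simp
  have "(CLINT \<omega>|M. iexp (2 * (w \<bullet> g \<omega>))) = (CLINT \<omega>|M. \<Prod>i\<in>UNIV. iexp (2 * (w $ i \<bullet> g \<omega> $ i)))"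
    by (simp add: inner_vec_def sum_distrib_left exp_sum)
  also have "\<dots> = (\<Prod>i\<in>UNIV. CLINT \<omega>|M. iexp (2 * (w $ i \<bullet> g \<omega> $ i)))"
  proof (rule indep_vars_lebesgue_integral)
    show "indep_vars (\<lambda>_. borel) (\<lambda>i \<omega>. iexp (2 * (w $ i \<bullet> g \<omega> $ i))) UNIV"
      by (rule indep_vars_compose2[OF indep]) simp
    show "integrable M (\<lambda>\<omega>. iexp (2 * (w $ i \<bullet> g \<omega> $ i)))" for i
      by (rule integrable_const_bound[where B=1]) auto
  qed simp
  also have "\<dots> = (\<Prod>i\<in>UNIV. complex_of_real (exp (- (norm (w $ i))\<^sup>2)))"
    by (simp only: std_complex_normal_char[OF normal])
  also have "\<dots> = complex_of_real (exp (- (norm w)\<^sup>2))"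
    by (simp add: exp_sum[symmetric] of_real_prod[symmetric] sum_negf norm_vec_def L2_set_def sum_nonneg
        del: of_real_prod)
  finally show ?thesis .
qed

lemma norm_sum_orthonormal:
  fixes e :: "'k \<Rightarrow> 'a::real_inner"
  assumes "finite K" and e: "\<And>k l. k \<in> K \<Longrightarrow> l \<in> K \<Longrightarrow> e k \<bullet> e l = (if k = l then 1 else 0)"
  shows "(norm (\<Sum>k\<in>K. c k *\<^sub>R e k))\<^sup>2 = (\<Sum>k\<in>K. (c k)\<^sup>2)"
proof -
  have "(norm (\<Sum>k\<in>K. c k *\<^sub>R e k))\<^sup>2 = (\<Sum>k\<in>K. \<Sum>l\<in>K. c k * (c l * (e l \<bullet> e k)))"
    by (simp add: power2_norm_eq_inner inner_sum_left inner_sum_right sum_distrib_left)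
  also have "\<dots> = (\<Sum>k\<in>K. \<Sum>l\<in>K. if k = l then (c k)\<^sup>2 else 0)"
    by (intro sum.cong refl) (auto simp: e power2_eq_square)
  also have "\<dots> = (\<Sum>k\<in>K. (c k)\<^sup>2)"
    using assms(1) by simp
  finally show ?thesis .
qed

text \<open>Each factor \<open>exp (- d t\<^sup>2)\<close> is the characteristic function of an auxiliary Gaussian variable. This
  linearises the exponent, so that the expectation over \<open>g\<close> is again a characteristic function and no
  rotation of Lebesgue measure is needed.\<close>

lemma (in prob_space) std_complex_normal_quadratic_form:
  fixes g :: "'a \<Rightarrow> complex^'n" and e :: "'k \<Rightarrow> complex^'n"
  assumes g[measurable]: "g \<in> borel_measurable M"
    and indep: "indep_vars (\<lambda>_. borel) (\<lambda>i \<omega>. g \<omega> $ i) UNIV"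
    and normal: "\<And>i. distributed M lborel (\<lambda>\<omega>. g \<omega> $ i)
                   (\<lambda>z. ennreal (std_complex_normal_density z))"
    and K: "finite K" and e: "\<And>k l. k \<in> K \<Longrightarrow> l \<in> K \<Longrightarrow> e k \<bullet> e l = (if k = l then 1 else 0)"
    and d: "\<And>k. k \<in> K \<Longrightarrow> d k \<ge> 0"
  shows "(\<integral>\<^sup>+\<omega>. ennreal (exp (- (\<Sum>k\<in>K. d k * (e k \<bullet> g \<omega>)\<^sup>2))) \<partial>M) = ennreal (\<Prod>k\<in>K. 1 / sqrt (1 + d k))"
proof -
  interpret N: prob_space half_normal by (rule prob_space_half_normal)
  have int_iexp: "integrable half_normal (\<lambda>y. iexp (2 * (c * y)))" for c
    by (rule N.integrable_const_bound[where B=1]) auto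
  have int_exp: "integrable half_normal (\<lambda>y. exp (- (c * y\<^sup>2)))" if "c \<ge> 0" for c
    by (rule N.integrable_const_bound[where B=1]) (use that in auto)
  interpret PN: product_prob_space "\<lambda>_. half_normal" K ..
  define P where "P = Pi\<^sub>M K (\<lambda>_. half_normal)"
  interpret P: prob_space P unfolding P_def by (rule prob_space_PiM) (rule prob_space_half_normal)
  interpret MP: pair_prob_space M P ..
  have [measurable]: "(\<lambda>\<xi>. \<xi> k) \<in> borel_measurable P" if "k \<in> K" for k
    using measurable_component_singleton[OF that, of "\<lambda>_. half_normal"] by (simp add: P_def cong: measurable_cong_sets)
  let ?v = "\<lambda>\<xi>. \<Sum>k\<in>K. (\<xi> k * sqrt (d k)) *\<^sub>R e k"
  have [measurable]: "?v \<in> borel_measurable P"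
    by measurable
  \<comment> \<open>The Hubbard-Stratonovich transformation: the coordinates of \<open>\<xi>\<close>
    are the auxiliary Gaussian variables, and the quadratic exponent becomes linear in x with the
    random coefficient vector \<open>?v\<close>.\<close>
  have HS: "complex_of_real (exp (- (\<Sum>k\<in>K. d k * (e k \<bullet> x)\<^sup>2))) = (CLINT \<xi>|P. iexp (2 * (?v \<xi> \<bullet> x)))" for x
  proof -
    have "complex_of_real (exp (- (\<Sum>k\<in>K. d k * (e k \<bullet> x)\<^sup>2)))
       = (\<Prod>k\<in>K. complex_of_real (exp (- (sqrt (d k) * (e k \<bullet> x))\<^sup>2)))"
      using K d by (simp add: exp_sum[symmetric] of_real_prod[symmetric] sum_negf power_mult_distrib del: of_real_prod)
    also have "\<dots> = (\<Prod>k\<in>K. CLINT y|half_normal. iexp (2 * (sqrt (d k) * (e k \<bullet> x) * y)))"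
      by (simp only: half_normal_char)
    also have "\<dots> = (CLINT \<xi>|P. \<Prod>k\<in>K. iexp (2 * (sqrt (d k) * (e k \<bullet> x) * \<xi> k)))"
      unfolding P_def
    proof (rule PN.product_integral_prod[symmetric, OF K])
      show "integrable half_normal (\<lambda>y. iexp (2 * (sqrt (d k) * (e k \<bullet> x) * y)))" for k
        by (rule int_iexp)
    qed
    also have "\<dots> = (CLINT \<xi>|P. iexp (2 * (?v \<xi> \<bullet> x)))"
      using K by (simp add: exp_sum[symmetric] inner_sum_left sum_distrib_left sum_distrib_right mult_ac)
    finally show ?thesis .
  qed
  have "complex_of_real (LINT \<omega>|M. exp (- (\<Sum>k\<in>K. d k * (e k \<bullet> g \<omega>)\<^sup>2)))
     = (CLINT \<omega>|M. complex_of_real (exp (- (\<Sum>k\<in>K. d k * (e k \<bullet> g \<omega>)\<^sup>2))))"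
    by (rule integral_complex_of_real[symmetric])
  also have "\<dots> = (CLINT \<omega>|M. CLINT \<xi>|P. iexp (2 * (?v \<xi> \<bullet> g \<omega>)))"
    by (simp only: HS)
  also have "\<dots> = (CLINT \<xi>|P. CLINT \<omega>|M. iexp (2 * (?v \<xi> \<bullet> g \<omega>)))"
    by (rule MP.Fubini_integral[symmetric]) (auto intro!: MP.P.integrable_const_bound[where B=1])
  also have "\<dots> = (CLINT \<xi>|P. complex_of_real (exp (- (norm (?v \<xi>))\<^sup>2)))"
    by (simp only: std_complex_normal_vector_char[OF indep normal])
  also have "\<dots> = complex_of_real (LINT \<xi>|P. exp (- (norm (?v \<xi>))\<^sup>2))"
    by (rule integral_complex_of_real)
  finally have "(LINT \<omega>|M. exp (- (\<Sum>k\<in>K. d k * (e k \<bullet> g \<omega>)\<^sup>2))) = (LINT \<xi>|P. exp (- (norm (?v \<xi>))\<^sup>2))"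
    by (simp only: of_real_eq_iff)
  \<comment> \<open>Orthonormality of the e k turns the squared norm of \<open>?v\<close> into a
    weighted sum of squares of the coordinates, so the remaining integral factors over K.\<close>
  also have "\<dots> = (LINT \<xi>|P. (\<Prod>k\<in>K. exp (- (d k * (\<xi> k)\<^sup>2))))"
    using K d by (subst norm_sum_orthonormal[OF K e])
      (auto simp: exp_sum[symmetric] sum_negf power_mult_distrib mult_ac)
  also have "\<dots> = (\<Prod>k\<in>K. LINT y|half_normal. exp (- (d k * y\<^sup>2)))"
    unfolding P_def
    by (rule PN.product_integral_prod) (use d in \<open>auto intro!: int_exp K\<close>)
  also have "\<dots> = (\<Prod>k\<in>K. 1 / sqrt (1 + d k))"
    using d by (intro prod.cong refl half_normal_exp_square) auto
  finally have *: "(LINT \<omega>|M. exp (- (\<Sum>k\<in>K. d k * (e k \<bullet> g \<omega>)\<^sup>2))) = (\<Prod>k\<in>K. 1 / sqrt (1 + d k))" .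
  have "integrable M (\<lambda>\<omega>. exp (- (\<Sum>k\<in>K. d k * (e k \<bullet> g \<omega>)\<^sup>2)))"
    using d by (intro integrable_const_bound[where B=1]) (auto intro!: sum_nonneg)
  then show ?thesis
    by (subst nn_integral_eq_integral) (auto simp: *)
qed

subsection \<open>Laplace functional of the Poisson process\<close>

text \<open>Source of the sinc in the bound: as Gamma 2 = 1, the left side is Gamma (1 - x) * Gamma
  (1 + x) = x Gamma x Gamma (1 - x), and the reflection formula applies.\<close>

lemma Beta_reflection:
  fixes x :: real
  assumes "0 < x" "x < 1"
  shows "Beta (1 - x) (1 + x) = 1 / nsinc x"
proof -
  have "complex_of_real (Gamma x * Gamma (1 - x)) = complex_of_real (pi / sin (pi * x))"
    using Gamma_reflection_complex[of "complex_of_real x"]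
    by (simp add: Gamma_complex_of_real[symmetric] sin_of_real[symmetric])
  then have refl: "Gamma x * Gamma (1 - x) = pi / sin (pi * x)"
    by (simp only: of_real_eq_iff)
  have "Beta (1 - x) (1 + x) = x * (Gamma x * Gamma (1 - x))"
  proof -
    have "x \<notin> \<int>\<^sub>\<le>\<^sub>0" using assms by (auto dest: nonpos_Ints_nonpos)
    then have "Gamma (1 + x) = x * Gamma x" using Gamma_plus1[of x] by (simp add: add.commute)
    moreover have "Gamma (2 :: real) = 1" using Gamma_fact[of 1, where 'a = real] by simp
    ultimately show ?thesis by (simp add: Beta_def)
  qed
  then show ?thesis by (simp add: refl nsinc_def)
qed

text \<open>Layer cake: the superlevel sets of the integrand are discs, which turns the integral over the
  plane into a Beta integral over the level.\<close>

lemma nn_integral_path_loss: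
  fixes a k :: real
  assumes a: "a > 2" and k: "k > 0"
  shows "(\<integral>\<^sup>+x. ennreal (k * norm x powr (- a) / (1 + k * norm x powr (- a))) \<partial>(lborel :: (real^2) measure))
    \<le> ennreal (k powr (2 / a) * pi / nsinc (2 / a))"
proof -
  define \<delta> where "\<delta> = 2 / a"
  have \<delta>: "0 < \<delta>" "\<delta> < 1" using a by (auto simp: \<delta>_def)
  define G where "G x = k * norm x powr (- a) / (1 + k * norm x powr (- a))" for x :: "real^2"
  \<comment> \<open>The radius at which the integrand takes the value t: solving u / (1 + u) = t for
    u = k r^(-a) gives r^a = k (1 - t) / t.\<close>
  define r where "r t = (k * (1 - t) / t) powr (1 / a)" for t
  have G0: "0 \<le> G x" for x using k by (simp add: G_def)
  have [measurable]: "G \<in> borel_measurable borel" "r \<in> borel_measurable borel"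
    unfolding G_def r_def by measurable
  \<comment> \<open>At the origin \<open>powr\<close> is 0, so G vanishes there and the superlevel
    set lacks its centre. Only the inclusion in the disc is used, which is why the result is an
    inequality.\<close>
  have level: "t < 1 \<and> norm x < r t" if t: "0 < t" "t < G x" for x t
  proof -
    have x: "norm x > 0" using that by (auto simp: G_def)
    define u where "u = k * norm x powr (- a)"
    have u: "u > 0" using x k by (simp add: u_def)
    have G: "G x = u / (1 + u)" by (simp add: G_def u_def)
    have "G x < 1" using u by (simp add: G)
    then have t1: "t < 1" using t by simp
    have "t < u * (1 - t)" using t u by (simp add: G field_simps)
    then have "t * norm x powr a < k * (1 - t)"
      using x by (simp add: u_def powr_minus field_simps)
    then have "norm x powr a < k * (1 - t) / t" using t by (simp add: field_simps)
    then have "(norm x powr a) powr (1 / a) < r t"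
      unfolding r_def using a by (intro powr_less_mono2) auto
    then show ?thesis using t1 a x by (simp add: powr_powr)
  qed
  \<comment> \<open>The area is pi times the square of the radius; the exponents are written in the
    form in which the Beta integral with parameters 1 - \<delta> and 1 + \<delta> has them.\<close>
  have vol: "emeasure lborel (ball (0::real^2) (r t)) = ennreal (k powr \<delta> * pi * (t powr (1 - \<delta> - 1) * (1 - t) powr (1 + \<delta> - 1)))"
    if "0 < t" "t < 1" for t
  proof -
    have "r t ^ 2 = (k * (1 - t) / t) powr \<delta>"
      using that k a by (simp add: r_def \<delta>_def powr_realpow[symmetric] powr_powr del: powr_realpow)
    also have "\<dots> = k powr \<delta> * (t powr (1 - \<delta> - 1) * (1 - t) powr (1 + \<delta> - 1))"
    proof -
      have "(k * (1 - t) / t) powr \<delta> = k powr \<delta> * (1 - t) powr \<delta> / t powr \<delta>"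
        using that k by (simp add: powr_divide powr_mult)
      then show ?thesis by (simp add: powr_minus_divide)
    qed
    finally show ?thesis
      using emeasure_ball[of "r t" "0 :: real^2"] by (simp add: r_def unit_ball_vol_2 mult_ac)
  qed
  have "(\<integral>\<^sup>+x. ennreal (G x) \<partial>lborel) = (\<integral>\<^sup>+x. (\<integral>\<^sup>+t. indicator {0<..<G x} t \<partial>lborel) \<partial>lborel)"
    using G0 by (intro nn_integral_cong) simp
  also have "\<dots> \<le> (\<integral>\<^sup>+(x::real^2). (\<integral>\<^sup>+t. indicator {0<..<1} t * (if norm x < r t then 1 else 0) \<partial>lborel) \<partial>lborel)"
    using level by (intro nn_integral_mono) (auto simp: indicator_def)
  also have "\<dots> = (\<integral>\<^sup>+t. (\<integral>\<^sup>+(x::real^2). indicator {0<..<1} t * (if norm x < r t then 1 else 0) \<partial>lborel) \<partial>lborel)"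
    by (rule lborel_pair.Fubini') measurable
  also have "\<dots> = (\<integral>\<^sup>+t. indicator {0<..<1} t * emeasure lborel (ball (0::real^2) (r t)) \<partial>lborel)"
  proof (rule nn_integral_cong)
    fix t
    have "(\<integral>\<^sup>+(x::real^2). indicator {0<..<1} t * (if norm x < r t then 1 else 0) \<partial>lborel)
      = indicator {0<..<1} t * (\<integral>\<^sup>+(x::real^2). (if norm x < r t then 1 else 0) \<partial>lborel)"
      by (rule nn_integral_cmult) measurable
    also have "(\<integral>\<^sup>+(x::real^2). (if norm x < r t then 1 else 0) \<partial>lborel) = (\<integral>\<^sup>+x. indicator (ball (0::real^2) (r t)) x \<partial>lborel)"
      by (intro nn_integral_cong) (auto simp: indicator_def)
    finally show "(\<integral>\<^sup>+(x::real^2). indicator {0<..<1} t * (if norm x < r t then 1 else 0) \<partial>lborel)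
      = indicator {0<..<1} t * emeasure lborel (ball (0::real^2) (r t))" by simp
  qed
  also have "\<dots> = (\<integral>\<^sup>+t. ennreal (k powr \<delta> * pi) * ennreal (indicator {0<..<1} t * (t powr (1 - \<delta> - 1) * (1 - t) powr (1 + \<delta> - 1))) \<partial>lborel)"
    by (intro nn_integral_cong) (auto simp: indicator_def vol ennreal_mult)
  also have "\<dots> = ennreal (k powr \<delta> * pi) * (\<integral>\<^sup>+t. ennreal (indicator {0<..<1} t * (t powr (1 - \<delta> - 1) * (1 - t) powr (1 + \<delta> - 1))) \<partial>lborel)"
    by (rule nn_integral_cmult) measurable
  also have "(\<integral>\<^sup>+t. ennreal (indicator {0<..<1} t * (t powr (1 - \<delta> - 1) * (1 - t) powr (1 + \<delta> - 1))) \<partial>lborel)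
      = ennreal (Beta (1 - \<delta>) (1 + \<delta>))"
    using has_integral_Beta_real[of "1 - \<delta>" "1 + \<delta>"] \<delta>
    by (intro nn_integral_has_integral_lebesgue) (auto simp: has_integral_Icc_iff_Ioo)
  also have "ennreal (k powr \<delta> * pi) * ennreal (Beta (1 - \<delta>) (1 + \<delta>)) = ennreal (k powr \<delta> * pi / nsinc \<delta>)"
    using \<delta> by (subst ennreal_mult'[symmetric]) (auto simp: Beta_reflection)
  finally show ?thesis by (simp add: G_def \<delta>_def)
qed

text \<open>\<open>poisson_weight c t\<close> is \<open>exp (- c t)\<close> for a finite count \<open>t\<close>, and \<open>0\<close> for an infinite one.\<close>

definition poisson_weight :: "real \<Rightarrow> ennreal \<Rightarrow> ennreal" where
  "poisson_weight c t = (\<Sum>k. ennreal (exp (- c * real k)) * indicator {of_nat k} t)"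

lemma poisson_weight_of_nat: "poisson_weight c (of_nat k) = ennreal (exp (- c * real k))"
  unfolding poisson_weight_def
  by (rule suminf_cmult_indicator) (auto simp: disjoint_family_on_def)

lemma poisson_weight_eq_0: "t \<notin> range of_nat \<Longrightarrow> poisson_weight c t = 0"
proof -
  assume "t \<notin> range of_nat"
  then have "indicator {of_nat k} t = (0 :: ennreal)" for k
    by (metis indicator_simps(2) rangeI singletonD)
  then show ?thesis by (simp add: poisson_weight_def)
qed

text \<open>To be used with m the number of points in a set among the first N: the weight of the
  full count, possibly infinite, is at most that of the partial count.\<close>

lemma poisson_weight_le:
  assumes "c \<ge> 0" "of_nat m \<le> t"
  shows "poisson_weight c t \<le> ennreal (exp (- c * real m))"
proof (cases "t \<in> range of_nat")
  case True
  then show ?thesis using assms by (auto simp: poisson_weight_of_nat intro!: ennreal_leI mult_left_mono)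
qed (simp add: poisson_weight_eq_0)

lemma borel_measurable_poisson_weight [measurable]: "poisson_weight c \<in> borel_measurable borel"
  unfolding poisson_weight_def by measurable

lemma borel_measurable_point_count:
  assumes [measurable]: "\<And>l. X l \<in> borel_measurable M" "B \<in> sets borel"
  shows "point_count X B \<in> borel_measurable M"
  unfolding point_count_def by measurable

text \<open>The generating function of the Poisson law with mean m, taken at exp (- c): the
  exponential series sums to exp (m exp (- c)) exp (- m).\<close>

lemma homogeneous_PPP_laplace_count:
  fixes X :: "nat \<Rightarrow> 'w \<Rightarrow> 'a::euclidean_space"
  assumes M: "prob_space M" and PPP: "homogeneous_PPP M lam X" and lam: "lam \<ge> 0"
    and B: "B \<in> sets borel" "bounded B"
  shows "(\<integral>\<^sup>+\<omega>. poisson_weight c (point_count X B \<omega>) \<partial>M)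
    = ennreal (exp (- lam * ((1 - exp (- c)) * measure lborel B)))"
proof -
  interpret prob_space M by fact
  define m where "m = lam * measure lborel B"
  have m: "m \<ge> 0" using lam by (simp add: m_def)
  have [measurable]: "point_count X B \<in> borel_measurable M"
    using PPP B by (intro borel_measurable_point_count) (auto simp: homogeneous_PPP_def)
  have "(\<integral>\<^sup>+\<omega>. poisson_weight c (point_count X B \<omega>) \<partial>M)
    = (\<Sum>k. \<integral>\<^sup>+\<omega>. ennreal (exp (- c * real k)) * indicator {of_nat k} (point_count X B \<omega>) \<partial>M)"
    unfolding poisson_weight_def by (rule nn_integral_suminf) measurable
  also have "\<dots> = (\<Sum>k. ennreal ((m * exp (- c)) ^ k / fact k * exp (- m)))"
  proof (rule suminf_cong)
    fix k :: nat
    let ?E = "{\<omega> \<in> space M. point_count X B \<omega> = of_nat k}"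
    have [measurable]: "?E \<in> sets M" by measurable
    have "(\<integral>\<^sup>+\<omega>. ennreal (exp (- c * real k)) * indicator {of_nat k} (point_count X B \<omega>) \<partial>M)
      = (\<integral>\<^sup>+\<omega>. ennreal (exp (- c * real k)) * indicator ?E \<omega> \<partial>M)"
      by (intro nn_integral_cong) (auto simp: indicator_def)
    also have "\<dots> = ennreal (exp (- c * real k)) * ennreal (prob ?E)"
      by (subst nn_integral_cmult_indicator) (auto simp: emeasure_eq_measure)
    also have "prob ?E = m ^ k / fact k * exp (- m)"
      using PPP B unfolding homogeneous_PPP_def m_def by blast
    also have "ennreal (exp (- c * real k)) * ennreal (m ^ k / fact k * exp (- m))
      = ennreal ((m * exp (- c)) ^ k / fact k * exp (- m))"
      using m by (simp add: ennreal_mult[symmetric] power_mult_distrib exp_of_nat_mult[symmetric] mult_ac)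
    finally show "(\<integral>\<^sup>+\<omega>. ennreal (exp (- c * real k)) * indicator {of_nat k} (point_count X B \<omega>) \<partial>M)
      = ennreal ((m * exp (- c)) ^ k / fact k * exp (- m))" .
  qed
  also have "\<dots> = ennreal (exp (m * exp (- c)) * exp (- m))"
  proof (rule suminf_ennreal_eq)
    show "(\<lambda>k. (m * exp (- c)) ^ k / fact k * exp (- m)) sums (exp (m * exp (- c)) * exp (- m))"
      using exp_converges[of "m * exp (- c)"] by (intro sums_mult2) (simp add: field_simps)
  qed (use m in auto)
  also have "exp (m * exp (- c)) * exp (- m) = exp (- lam * ((1 - exp (- c)) * measure lborel B))"
    by (simp add: exp_add[symmetric] m_def algebra_simps)
  finally show ?thesis .
qed

text \<open>For a step function the product over all points is a product of functions of the counts
  in disjoint sets; independence gives the exact value exp (- lam * integral of 1 - exp (- f)).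
  Keeping only the first N points discards factors at most 1, which accounts for the inequality and
  avoids infinite products.\<close>

lemma homogeneous_PPP_laplace_step:
  fixes X :: "nat \<Rightarrow> 'w \<Rightarrow> 'a::euclidean_space" and n :: nat
  assumes M: "prob_space M" and PPP: "homogeneous_PPP M lam X" and lam: "lam \<ge> 0"
    and B: "\<And>i. i < n \<Longrightarrow> B i \<in> sets borel" "\<And>i. i < n \<Longrightarrow> bounded (B i)"
    and disj: "disjoint_family_on B {..<n}" and c: "\<And>i. i < n \<Longrightarrow> c i \<ge> 0"
    and f: "\<And>x. f x = (\<Sum>i<n. c i * indicator (B i) x)"
    and J: "(\<integral>\<^sup>+x. ennreal (1 - exp (- f x)) \<partial>lborel) \<le> ennreal J" and J0: "J \<ge> 0"
  shows "ennreal (exp (- lam * J)) \<le> (\<integral>\<^sup>+\<omega>. ennreal (\<Prod>l<N. exp (- f (X l \<omega>))) \<partial>M)"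
proof -
  interpret prob_space M by fact
  have Xm[measurable]: "X l \<in> borel_measurable M" for l
    using PPP by (auto simp: homogeneous_PPP_def)
  have fin: "emeasure lborel (B i) = ennreal (measure lborel (B i))" if "i < n" for i
    using B[OF that] by (intro emeasure_eq_ennreal_measure) (use emeasure_bounded_finite[of "B i"] in auto)
  \<comment> \<open>By disjointness at most one set contains x, so 1 - exp (- f) is itself a step
    function with values 1 - exp (- c i), and the sum is its integral.\<close>
  have 1: "(\<Sum>i<n. (1 - exp (- c i)) * measure lborel (B i)) \<le> J"
  proof -
    have "ennreal (\<Sum>i<n. (1 - exp (- c i)) * measure lborel (B i))
      = (\<Sum>i<n. ennreal (1 - exp (- c i)) * emeasure lborel (B i))"
      using c by (subst sum_ennreal[symmetric]) (auto simp: fin ennreal_mult intro!: sum.cong)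
    also have "\<dots> = (\<Sum>i<n. \<integral>\<^sup>+x. ennreal (1 - exp (- c i)) * indicator (B i) x \<partial>lborel)"
      using B by (intro sum.cong refl) (simp add: nn_integral_cmult_indicator)
    also have "\<dots> = (\<integral>\<^sup>+x. (\<Sum>i<n. ennreal (1 - exp (- c i)) * indicator (B i) x) \<partial>lborel)"
      using B by (subst nn_integral_sum) auto
    also have "\<dots> = (\<integral>\<^sup>+x. ennreal (1 - exp (- f x)) \<partial>lborel)"
    proof (rule nn_integral_cong)
      fix x
      show "(\<Sum>i<n. ennreal (1 - exp (- c i)) * indicator (B i) x) = ennreal (1 - exp (- f x))"
      proof (cases "\<exists>i<n. x \<in> B i")
        case True
        then obtain j where j: "j < n" "x \<in> B j" by blast
        have "(\<Sum>i<n. ennreal (1 - exp (- c i)) * indicator (B i) x) = (\<Sum>i\<in>{..<n}. if i = j then ennreal (1 - exp (- c i)) else 0)"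
          by (intro sum.cong refl) (use j disj in \<open>auto simp: disjoint_family_on_def indicator_def\<close>)
        moreover have "f x = (\<Sum>i<n. if i = j then c i else 0)"
          unfolding f by (intro sum.cong refl) (use j disj in \<open>auto simp: disjoint_family_on_def indicator_def\<close>)
        ultimately show ?thesis using j by simp
      next
        case False
        then show ?thesis by (auto simp: f indicator_def)
      qed
    qed
    finally have "ennreal (\<Sum>i<n. (1 - exp (- c i)) * measure lborel (B i)) \<le> ennreal J" using J by simp
    then show ?thesis using J0 by (simp add: ennreal_le_iff)
  qed
  have "ennreal (exp (- lam * J)) \<le> ennreal (exp (- lam * (\<Sum>i<n. (1 - exp (- c i)) * measure lborel (B i))))"
    using 1 lam by (intro ennreal_leI) (simp add: mult_left_mono)
  also have "\<dots> = (\<Prod>i<n. ennreal (exp (- lam * ((1 - exp (- c i)) * measure lborel (B i)))))"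
    by (simp add: prod_ennreal exp_sum[symmetric] sum_distrib_left sum_negf)
  also have "\<dots> = (\<Prod>i<n. \<integral>\<^sup>+\<omega>. poisson_weight (c i) (point_count X (B i) \<omega>) \<partial>M)"
    using B by (intro prod.cong refl homogeneous_PPP_laplace_count[OF M PPP lam, symmetric]) auto
  also have "\<dots> = (\<integral>\<^sup>+\<omega>. (\<Prod>i<n. poisson_weight (c i) (point_count X (B i) \<omega>)) \<partial>M)"
  proof (rule indep_vars_nn_integral[symmetric])
    have "indep_vars (\<lambda>_. borel) (\<lambda>i. point_count X (B i)) {..<n}"
      using PPP B disj unfolding homogeneous_PPP_def by blast
    then show "indep_vars (\<lambda>_. borel) (\<lambda>i \<omega>. poisson_weight (c i) (point_count X (B i) \<omega>)) {..<n}"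
      by (rule indep_vars_compose2) measurable
  qed auto
  also have "\<dots> \<le> (\<integral>\<^sup>+\<omega>. ennreal (\<Prod>l<N. exp (- f (X l \<omega>))) \<partial>M)"
  proof (rule nn_integral_mono)
    fix \<omega>
    define m where "m i = card {l\<in>{..<N}. X l \<omega> \<in> B i}" for i
    have m: "(\<Sum>l<N. indicator (B i) (X l \<omega>)) = real (m i)" for i
      by (simp add: m_def indicator_def sum.If_cases Int_def)
    have m': "(\<Sum>l<N. indicator (B i) (X l \<omega>)) = (of_nat (m i) :: ennreal)" for i
      by (simp add: m_def indicator_def sum.If_cases Int_def)
    have "(\<Prod>i<n. poisson_weight (c i) (point_count X (B i) \<omega>)) \<le> (\<Prod>i<n. ennreal (exp (- c i * real (m i))))"
    proof (rule prod_mono_ennreal)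
      fix i assume "i \<in> {..<n}"
      have "of_nat (m i) \<le> point_count X (B i) \<omega>"
        unfolding point_count_def m'[symmetric] by (rule sum_le_suminf) auto
      then show "poisson_weight (c i) (point_count X (B i) \<omega>) \<le> ennreal (exp (- c i * real (m i)))"
        using c \<open>i \<in> {..<n}\<close> by (intro poisson_weight_le) auto
    qed
    also have "\<dots> = ennreal (exp (\<Sum>i<n. \<Sum>l<N. - (c i * indicator (B i) (X l \<omega>))))"
      by (simp add: prod_ennreal exp_sum[symmetric] m[symmetric] sum_distrib_left sum_negf)
    also have "(\<Sum>i<n. \<Sum>l<N. - (c i * indicator (B i) (X l \<omega>))) = (\<Sum>l<N. - f (X l \<omega>))"
      by (subst sum.swap) (simp add: f sum_negf)
    finally show "(\<Prod>i<n. poisson_weight (c i) (point_count X (B i) \<omega>)) \<le> ennreal (\<Prod>l<N. exp (- f (X l \<omega>)))"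
      by (simp add: exp_sum)
  qed
  finally show ?thesis .
qed

text \<open>f is approximated from below by step functions h m. As h m <= f, the same J serves for
  all of them, and for fixed N the finite products converge under the bound 1.\<close>

lemma homogeneous_PPP_laplace_ge:
  fixes X :: "nat \<Rightarrow> 'w \<Rightarrow> 'a::euclidean_space"
  assumes M: "prob_space M" and PPP: "homogeneous_PPP M lam X" and lam: "lam \<ge> 0"
    and [measurable]: "f \<in> borel_measurable borel" and f0: "\<And>x. f x \<ge> 0"
    and J: "(\<integral>\<^sup>+x. ennreal (1 - exp (- f x)) \<partial>lborel) \<le> ennreal J" and J0: "J \<ge> 0"
  shows "ennreal (exp (- lam * J)) \<le> (\<integral>\<^sup>+\<omega>. ennreal (\<Prod>l<N. exp (- f (X l \<omega>))) \<partial>M)"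
proof -
  interpret prob_space M by fact
  have Xm[measurable]: "X l \<in> borel_measurable M" for l
    using PPP by (auto simp: homogeneous_PPP_def)
  obtain s where s: "\<And>i. simple_function borel (s i)" "incseq s" "\<And>i x. s i x < top" "\<And>x. (SUP i. s i x) = ennreal (f x)"
    using borel_measurable_implies_simple_function_sequence'[of "\<lambda>x. ennreal (f x)" borel] by auto
  have sm[measurable]: "s i \<in> borel_measurable borel" for i
    using s(1) by (rule borel_measurable_simple_function)
  \<comment> \<open>The cut to a ball makes the level sets bounded, as the Poisson counts are
    prescribed for bounded sets only; its radius grows with m, so the limit is still f.\<close>
  define h where "h m x = enn2real (s m x) * indicator (ball 0 (real m)) x" for m x
  have [measurable]: "ball (0 :: 'a) (real m) \<in> sets borel" for m by simp
  have hm[measurable]: "h m \<in> borel_measurable borel" for m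
    unfolding h_def by measurable
  have s_le: "s m x \<le> ennreal (f x)" for m x
    unfolding s(4)[symmetric] by (rule SUP_upper) simp
  have h_le: "h m x \<le> f x" and h0: "0 \<le> h m x" for m x
    using enn2real_mono[OF s_le[of m x]] f0[of x] by (auto simp: h_def indicator_def)
  have lim: "(\<lambda>m. h m x) \<longlonglongrightarrow> f x" for x
  proof -
    have "(\<lambda>m. s m x) \<longlonglongrightarrow> ennreal (f x)"
      unfolding s(4)[symmetric] using s(2) by (intro LIMSEQ_SUP) (auto simp: incseq_def le_fun_def)
    then have "(\<lambda>m. enn2real (s m x)) \<longlonglongrightarrow> f x"
      using f0 by (intro tendsto_enn2real) auto
    moreover have "eventually (\<lambda>m. enn2real (s m x) = h m x) sequentially"
    proof -
      obtain m0 :: nat where "norm x < real m0" using reals_Archimedean2 by blast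
      then show ?thesis
        unfolding eventually_sequentially by (intro exI[of _ m0]) (auto simp: h_def indicator_def)
    qed
    ultimately show ?thesis by (rule Lim_transform_eventually)
  qed
  have step: "ennreal (exp (- lam * J)) \<le> (\<integral>\<^sup>+\<omega>. ennreal (\<Prod>l<N. exp (- h m (X l \<omega>))) \<partial>M)" for m
  proof -
    have fin: "finite (range (s m))" using simple_functionD(1)[OF s(1)[of m]] by simp
    then obtain y where y: "bij_betw y {0..<card (range (s m))} (range (s m))"
      using ex_bij_betw_nat_finite by blast
    define n where "n = card (range (s m))"
    define B where "B i = s m -` {y i} \<inter> ball 0 (real m)" for i
    show ?thesis
    proof (rule homogeneous_PPP_laplace_step[OF M PPP lam, where n=n and B=B and c="\<lambda>i. enn2real (y i)"])
      show "B i \<in> sets borel" for i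
      proof -
        have "s m -` {y i} \<in> sets borel" using measurable_sets[OF sm, of "{y i}" m] by simp
        then show ?thesis unfolding B_def by (intro sets.Int) auto
      qed
      show "bounded (B i)" for i unfolding B_def by (intro bounded_Int disjI2 bounded_ball)
      have inj: "i < n \<Longrightarrow> j < n \<Longrightarrow> y i = y j \<Longrightarrow> i = j" for i j
        using y by (auto simp: bij_betw_def inj_on_def n_def)
      show "disjoint_family_on B {..<n}"
        using inj by (auto simp: disjoint_family_on_def B_def)
      show "h m x = (\<Sum>i<n. enn2real (y i) * indicator (B i) x)" for x
      proof -
        have "s m x \<in> y ` {0..<n}" using y by (auto simp: bij_betw_def n_def)
        then obtain j where j: "j < n" "y j = s m x" by auto
        have "(\<Sum>i<n. enn2real (y i) * indicator (B i) x) = (\<Sum>i<n. if i = j then h m x else 0)"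
          by (intro sum.cong refl) (use j inj in \<open>auto simp: B_def h_def indicator_def\<close>)
        then show ?thesis using j by simp
      qed
      have "(\<integral>\<^sup>+x. ennreal (1 - exp (- h m x)) \<partial>lborel) \<le> (\<integral>\<^sup>+x. ennreal (1 - exp (- f x)) \<partial>lborel)"
        using h_le by (intro nn_integral_mono ennreal_leI) simp
      then show "(\<integral>\<^sup>+x. ennreal (1 - exp (- h m x)) \<partial>lborel) \<le> ennreal J" using J by (rule order_trans)
    qed (use J0 in auto)
  qed
  have "(\<lambda>m. \<integral>\<^sup>+\<omega>. ennreal (\<Prod>l<N. exp (- h m (X l \<omega>))) \<partial>M) \<longlonglongrightarrow> (\<integral>\<^sup>+\<omega>. ennreal (\<Prod>l<N. exp (- f (X l \<omega>))) \<partial>M)"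
  proof (rule nn_integral_dominated_convergence[where w="\<lambda>_. 1"])
    show "AE \<omega> in M. (\<lambda>m. ennreal (\<Prod>l<N. exp (- h m (X l \<omega>)))) \<longlonglongrightarrow> ennreal (\<Prod>l<N. exp (- f (X l \<omega>)))"
      by (intro AE_I2 tendsto_ennrealI tendsto_prod tendsto_exp tendsto_minus lim)
    show "AE \<omega> in M. ennreal (\<Prod>l<N. exp (- h m (X l \<omega>))) \<le> 1" for m
      using h0 by (intro AE_I2) (auto simp: ennreal_le_1 intro!: prod_le_1)
  qed (auto simp: emeasure_space_1)
  then show ?thesis
    by (rule LIMSEQ_le_const) (use step in auto)
qed

subsection \<open>Gains under correlated fading\<close>

text \<open>The inner product on \<open>complex^'n\<close> is the real one, and a real matrix acts
  on real and imaginary parts separately. A real eigenbasis of C therefore suffices for complex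
  vectors.\<close>

definition Re_vec :: "complex^'n \<Rightarrow> real^'n" where "Re_vec y = (\<chi> i. Re (y $ i))"
definition Im_vec :: "complex^'n \<Rightarrow> real^'n" where "Im_vec y = (\<chi> i. Im (y $ i))"

lemma inner_complex_vec: "x \<bullet> y = Re_vec x \<bullet> Re_vec y + Im_vec x \<bullet> Im_vec y"
  by (simp add: inner_vec_def inner_complex_def Re_vec_def Im_vec_def sum.distrib)

lemma norm_complex_vec: "(norm y)\<^sup>2 = (norm (Re_vec y))\<^sup>2 + (norm (Im_vec y))\<^sup>2"
  by (simp add: power2_norm_eq_inner inner_complex_vec)

lemma Re_vec_complex_matrix: "Re_vec (complex_matrix A *v y) = A *v Re_vec y"
  and Im_vec_complex_matrix: "Im_vec (complex_matrix A *v y) = A *v Im_vec y"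
  by (simp_all add: vec_eq_iff Re_vec_def Im_vec_def complex_matrix_def matrix_vector_mult_def)

lemma orthonormal_expansion:
  fixes Q :: "'n::finite \<Rightarrow> real^'n"
  assumes Q: "\<And>i j. Q i \<bullet> Q j = (if i = j then 1 else 0)"
  shows "x = (\<Sum>i\<in>UNIV. (Q i \<bullet> x) *\<^sub>R Q i)"
proof -
  define U :: "real^'n^'n" where "U = (\<chi> i. Q i)"
  have "U ** transpose U = mat 1"
    using Q by (simp add: vec_eq_iff U_def matrix_matrix_mult_def transpose_def mat_def inner_vec_def)
  then have "transpose U ** U = mat 1" by (simp add: matrix_left_right_inverse)
  then have "x = transpose U *v (U *v x)" by (simp add: matrix_vector_mul_assoc)
  also have "\<dots> = (\<Sum>i\<in>UNIV. (Q i \<bullet> x) *\<^sub>R Q i)"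
    by (simp add: vec_eq_iff U_def matrix_vector_mult_def transpose_def inner_vec_def mult.commute)
  finally show ?thesis .
qed

lemma norm_orthonormal_coordinates:
  fixes Q :: "'n::finite \<Rightarrow> real^'n"
  assumes Q: "\<And>i j. Q i \<bullet> Q j = (if i = j then 1 else 0)"
  shows "(norm x)\<^sup>2 = (\<Sum>i\<in>UNIV. (Q i \<bullet> x)\<^sup>2)"
  by (subst orthonormal_expansion[OF Q, of x], rule norm_sum_orthonormal) (auto simp: Q)

text \<open>Symmetry of S gives |S x|^2 = x . S (S x) = x . C x, so the eigenvectors of C do all the
  work and S need not be diagonalized.\<close>

lemma norm_psd_sqrt:
  fixes C S :: "real^'n^'n" and Q :: "'n \<Rightarrow> real^'n"
  assumes S: "is_psd_sqrt S C"
    and Q: "\<And>i j. Q i \<bullet> Q j = (if i = j then 1 else 0)" and C: "\<And>i. C *v Q i = d i *\<^sub>R Q i"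
  shows "(norm (S *v x))\<^sup>2 = (\<Sum>i\<in>UNIV. d i * (Q i \<bullet> x)\<^sup>2)"
proof -
  have "(norm (S *v x))\<^sup>2 = x \<bullet> (C *v x)"
    using S dot_lmul_matrix[of x S "S *v x"]
    by (simp add: is_psd_sqrt_def psd_matrix_def power2_norm_eq_inner matrix_vector_mul_assoc
        flip: transpose_matrix_vector)
  also have "C *v x = (\<Sum>i\<in>UNIV. (d i * (Q i \<bullet> x)) *\<^sub>R Q i)"
    by (subst orthonormal_expansion[OF Q, of x])
      (simp add: linear_sum[OF matrix_vector_mul_linear] matrix_vector_mult_scaleR C mult.commute)
  finally show ?thesis
    by (simp add: inner_sum_right inner_commute power2_eq_square mult_ac)
qed

lemma norm_complex_psd_sqrt:
  fixes C S :: "real^'n^'n" and Q :: "'n \<Rightarrow> real^'n"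
  assumes S: "is_psd_sqrt S C"
    and Q: "\<And>i j. Q i \<bullet> Q j = (if i = j then 1 else 0)" and C: "\<And>i. C *v Q i = d i *\<^sub>R Q i"
  shows "(norm (complex_matrix S *v y))\<^sup>2
    = (\<Sum>i\<in>UNIV. d i * ((Q i \<bullet> Re_vec y)\<^sup>2 + (Q i \<bullet> Im_vec y)\<^sup>2))"
  by (simp add: norm_complex_vec Re_vec_complex_matrix Im_vec_complex_matrix norm_psd_sqrt[OF S Q C]
      sum.distrib algebra_simps)

lemma norm_complex_psd_sqrt_le:
  fixes C S :: "real^'n^'n" and Q :: "'n \<Rightarrow> real^'n"
  assumes S: "is_psd_sqrt S C"
    and Q: "\<And>i j. Q i \<bullet> Q j = (if i = j then 1 else 0)" and C: "\<And>i. C *v Q i = d i *\<^sub>R Q i"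
    and le: "\<And>i. d i \<le> m"
  shows "(norm (complex_matrix S *v y))\<^sup>2 \<le> m * (norm y)\<^sup>2"
proof -
  have "(norm (complex_matrix S *v y))\<^sup>2 \<le> (\<Sum>i\<in>UNIV. m * ((Q i \<bullet> Re_vec y)\<^sup>2 + (Q i \<bullet> Im_vec y)\<^sup>2))"
    unfolding norm_complex_psd_sqrt[OF S Q C] using le by (intro sum_mono mult_right_mono) auto
  also have "\<dots> = m * (norm y)\<^sup>2"
    by (simp add: norm_complex_vec norm_orthonormal_coordinates[OF Q] sum_distrib_left[symmetric] sum.distrib)
  finally show ?thesis .
qed

text \<open>Over the reals, every eigenvector of C yields two orthonormal directions, Q i and its
  multiple by the imaginary unit, with the same weight. Their factors 1 / sqrt (1 + s d i) combine
  to 1 / (1 + s d i).\<close>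

lemma (in prob_space) std_complex_normal_psd_sqrt_laplace:
  fixes C S :: "real^'n^'n" and Q :: "'n \<Rightarrow> real^'n" and g :: "'a \<Rightarrow> complex^'n"
  assumes g: "g \<in> borel_measurable M"
    and indep: "indep_vars (\<lambda>_. borel) (\<lambda>i \<omega>. g \<omega> $ i) UNIV"
    and normal: "\<And>i. distributed M lborel (\<lambda>\<omega>. g \<omega> $ i)
                   (\<lambda>z. ennreal (std_complex_normal_density z))"
    and S: "is_psd_sqrt S C"
    and Q: "\<And>i j. Q i \<bullet> Q j = (if i = j then 1 else 0)" and C: "\<And>i. C *v Q i = d i *\<^sub>R Q i"
    and d: "\<And>i. d i \<ge> 0" and s: "s \<ge> 0"
  shows "(\<integral>\<^sup>+\<omega>. ennreal (exp (- (s * (norm (complex_matrix S *v g \<omega>))\<^sup>2))) \<partial>M)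
    = ennreal (\<Prod>i\<in>UNIV. 1 / (1 + s * d i))"
proof -
  define e :: "'n \<times> bool \<Rightarrow> complex^'n" where
    "e = (\<lambda>(i, b). if b then (\<chi> j. \<i> * of_real (Q i $ j)) else (\<chi> j. of_real (Q i $ j)))"
  have Re_e: "Re_vec (e (i, b)) = (if b then 0 else Q i)" for i b
    by (auto simp: e_def Re_vec_def vec_eq_iff)
  have Im_e: "Im_vec (e (i, b)) = (if b then Q i else 0)" for i b
    by (auto simp: e_def Im_vec_def vec_eq_iff)
  have split: "(\<Sum>k\<in>UNIV. f k) = (\<Sum>i\<in>UNIV. f (i, True) + f (i, False))" for f :: "'n \<times> bool \<Rightarrow> real"
    by (subst UNIV_Times_UNIV[symmetric], subst sum.cartesian_product') (simp add: UNIV_bool add.commute)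
  have splitp: "(\<Prod>k\<in>UNIV. f k) = (\<Prod>i\<in>UNIV. f (i, True) * f (i, False))" for f :: "'n \<times> bool \<Rightarrow> real"
    by (subst UNIV_Times_UNIV[symmetric], subst prod.cartesian_product') (simp add: UNIV_bool mult.commute)
  have "(\<integral>\<^sup>+\<omega>. ennreal (exp (- (\<Sum>k\<in>UNIV. (s * d (fst k)) * (e k \<bullet> g \<omega>)\<^sup>2))) \<partial>M)
     = ennreal (\<Prod>k\<in>(UNIV :: ('n \<times> bool) set). 1 / sqrt (1 + s * d (fst k)))"
  proof (rule std_complex_normal_quadratic_form[OF g indep normal])
    show "e k \<bullet> e l = (if k = l then 1 else 0)" for k l
      by (cases k; cases l) (auto simp: inner_complex_vec Re_e Im_e Q)
  qed (use d s in auto)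
  moreover have "(\<Sum>k\<in>UNIV. (s * d (fst k)) * (e k \<bullet> y)\<^sup>2) = s * (norm (complex_matrix S *v y))\<^sup>2" for y
    unfolding norm_complex_psd_sqrt[OF S Q C] split
    by (simp add: inner_complex_vec Re_e Im_e sum_distrib_left algebra_simps)
  moreover have "(\<Prod>k\<in>(UNIV :: ('n \<times> bool) set). 1 / sqrt (1 + s * d (fst k))) = (\<Prod>i\<in>UNIV. 1 / (1 + s * d i))"
    unfolding splitp using d s by (intro prod.cong refl) (simp add: add_nonneg_nonneg)
  ultimately show ?thesis by simp
qed

text \<open>The squared modulus is exponential with mean |v|^2: real and imaginary part of the
  product are the real inner products of g with v and with w = i v, two orthogonal vectors of equal
  length.\<close>

lemma (in prob_space) std_complex_normal_herm_prod_laplace: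
  fixes g :: "'a \<Rightarrow> complex^'n"
  assumes g: "g \<in> borel_measurable M"
    and indep: "indep_vars (\<lambda>_. borel) (\<lambda>i \<omega>. g \<omega> $ i) UNIV"
    and normal: "\<And>i. distributed M lborel (\<lambda>\<omega>. g \<omega> $ i)
                   (\<lambda>z. ennreal (std_complex_normal_density z))"
    and s: "s \<ge> 0"
  shows "(\<integral>\<^sup>+\<omega>. ennreal (exp (- (s * (cmod (herm_prod v (g \<omega>)))\<^sup>2))) \<partial>M)
    = ennreal (1 / (1 + s * (norm v)\<^sup>2))"
proof (cases "v = 0")
  case True
  then show ?thesis by (simp add: herm_prod_def emeasure_space_1)
next
  case False
  define w :: "complex^'n" where "w = (\<chi> j. \<i> * v $ j)"
  have w: "Re_vec w = - Im_vec v" "Im_vec w = Re_vec v"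
    by (auto simp: w_def Re_vec_def Im_vec_def vec_eq_iff)
  define e where "e b = (if b then v /\<^sub>R norm v else w /\<^sub>R norm v)" for b
  have ww: "w \<bullet> w = (norm v)\<^sup>2" "v \<bullet> w = 0" "w \<bullet> v = 0"
    by (simp_all add: inner_complex_vec w norm_complex_vec power2_norm_eq_inner inner_commute)
  have nw: "norm w = norm v"
    using ww(1) by (simp add: dot_square_norm)
  have "(\<integral>\<^sup>+\<omega>. ennreal (exp (- (\<Sum>k\<in>UNIV. (s * (norm v)\<^sup>2) * (e k \<bullet> g \<omega>)\<^sup>2))) \<partial>M)
     = ennreal (\<Prod>k\<in>(UNIV::bool set). 1 / sqrt (1 + s * (norm v)\<^sup>2))"
  proof (rule std_complex_normal_quadratic_form[OF g indep normal])
    show "e k \<bullet> e l = (if k = l then 1 else 0)" for k l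
      using False by (cases k; cases l) (auto simp: e_def ww nw dot_square_norm power2_eq_square)
  qed (use s in auto)
  moreover have "(\<Sum>k\<in>UNIV. (s * (norm v)\<^sup>2) * (e k \<bullet> y)\<^sup>2) = s * (cmod (herm_prod v y))\<^sup>2" for y
  proof -
    have "Re (herm_prod v y) = v \<bullet> y" "Im (herm_prod v y) = w \<bullet> y"
      by (simp_all add: herm_prod_def inner_vec_def inner_complex_def w_def)
    then show ?thesis
      using False by (simp add: cmod_power2 UNIV_bool e_def power_divide field_simps)
  qed
  moreover have "(\<Prod>k\<in>(UNIV::bool set). 1 / sqrt (1 + s * (norm v)\<^sup>2)) = 1 / (1 + s * (norm v)\<^sup>2)"
    using s by (simp add: UNIV_bool)
  ultimately show ?thesis by simp
qed

lemma herm_prod_complex_matrix: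
  assumes "transpose A = A"
  shows "herm_prod u (complex_matrix A *v y) = herm_prod (complex_matrix A *v u) y"
proof -
  have sym: "A $ i $ j = A $ j $ i" for i j
    using arg_cong[OF assms, of "\<lambda>B. B $ j $ i"] by (simp add: transpose_def)
  have "herm_prod u (complex_matrix A *v y)
      = (\<Sum>i\<in>UNIV. \<Sum>j\<in>UNIV. cnj (u $ i) * (of_real (A $ i $ j) * y $ j))"
    by (simp add: herm_prod_def complex_matrix_def matrix_vector_mult_def sum_distrib_left)
  also have "\<dots> = (\<Sum>j\<in>UNIV. \<Sum>i\<in>UNIV. cnj (u $ i) * (of_real (A $ i $ j) * y $ j))"
    by (rule sum.swap)
  also have "\<dots> = herm_prod (complex_matrix A *v u) y"
    unfolding herm_prod_def
  proof (rule sum.cong[OF refl])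
    fix j
    have "cnj ((complex_matrix A *v u) $ j) * y $ j = (\<Sum>i\<in>UNIV. cnj (u $ i) * (of_real (A $ j $ i) * y $ j))"
      by (simp add: complex_matrix_def matrix_vector_mult_def sum_distrib_left mult_ac)
    then show "(\<Sum>i\<in>UNIV. cnj (u $ i) * (of_real (A $ i $ j) * y $ j)) = cnj ((complex_matrix A *v u) $ j) * y $ j"
      by (simp add: sym[of _ j])
  qed
  finally show ?thesis .
qed

text \<open>h stands for the direct fading, frozen. Moving the symmetric S to the other side shows
  that the gain is exponential with mean |S h|^2 / |h|^2, a Rayleigh quotient of C and so at most
  m.\<close>

lemma (in prob_space) std_complex_normal_interferer_laplace:
  fixes C S :: "real^'n^'n" and Q :: "'n \<Rightarrow> real^'n" and g :: "'a \<Rightarrow> complex^'n"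
  assumes g: "g \<in> borel_measurable M"
    and indep: "indep_vars (\<lambda>_. borel) (\<lambda>i \<omega>. g \<omega> $ i) UNIV"
    and normal: "\<And>i. distributed M lborel (\<lambda>\<omega>. g \<omega> $ i)
                   (\<lambda>z. ennreal (std_complex_normal_density z))"
    and S: "is_psd_sqrt S C"
    and Q: "\<And>i j. Q i \<bullet> Q j = (if i = j then 1 else 0)" and C: "\<And>i. C *v Q i = d i *\<^sub>R Q i"
    and le: "\<And>i. d i \<le> m" and m: "m \<ge> 0" and s: "s \<ge> 0"
  shows "ennreal (1 / (1 + s * m))
    \<le> (\<integral>\<^sup>+\<omega>. ennreal (exp (- (s * ((cmod (herm_prod h (complex_matrix S *v g \<omega>)))\<^sup>2 / (norm h)\<^sup>2)))) \<partial>M)"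
proof -
  let ?v = "complex_matrix S *v h"
  have "s * (norm ?v)\<^sup>2 / (norm h)\<^sup>2 \<le> s * m"
  \<comment> \<open>For h = 0 division by zero makes the quotient 0, and the bound still
    holds.\<close>
  proof (cases "h = 0")
    case False
    have "(norm ?v)\<^sup>2 / (norm h)\<^sup>2 \<le> m"
      using norm_complex_psd_sqrt_le[OF S Q C le] False by (simp add: field_simps)
    from mult_left_mono[OF this s] show ?thesis by simp
  qed (use m s in simp)
  then have "ennreal (1 / (1 + s * m)) \<le> ennreal (1 / (1 + s / (norm h)\<^sup>2 * (norm ?v)\<^sup>2))"
    using s m by (intro ennreal_leI divide_left_mono) (auto intro!: mult_pos_pos add_pos_nonneg)
  also have "\<dots> = (\<integral>\<^sup>+\<omega>. ennreal (exp (- (s / (norm h)\<^sup>2 * (cmod (herm_prod ?v (g \<omega>)))\<^sup>2))) \<partial>M)"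
    using s by (intro std_complex_normal_herm_prod_laplace[OF g indep normal, symmetric]) auto
  also have "\<dots> = (\<integral>\<^sup>+\<omega>. ennreal (exp (- (s * ((cmod (herm_prod h (complex_matrix S *v g \<omega>)))\<^sup>2 / (norm h)\<^sup>2)))) \<partial>M)"
    using S by (simp add: herm_prod_complex_matrix is_psd_sqrt_def psd_matrix_def)
  finally show ?thesis .
qed

subsection \<open>Independence of the sources\<close>

text \<open>The substitute for conditioning on Y: the joint law is a product, so Tonelli freezes Y
  and averages over an independent copy of Z, realised by a second sample point.\<close>

lemma (in prob_space) nn_integral_indep_var:
  assumes indep: "indep_var S Y T Z" and f[measurable]: "f \<in> borel_measurable (S \<Otimes>\<^sub>M T)"
  shows "(\<integral>\<^sup>+\<omega>. f (Y \<omega>, Z \<omega>) \<partial>M) = (\<integral>\<^sup>+\<omega>. (\<integral>\<^sup>+\<omega>'. f (Y \<omega>, Z \<omega>') \<partial>M) \<partial>M)"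
proof -
  have [measurable]: "Y \<in> measurable M S" "Z \<in> measurable M T"
    using indep by (auto dest: indep_var_rv1 indep_var_rv2)
  interpret T: prob_space "distr M T Z" by (rule prob_space_distr) measurable
  have "(\<integral>\<^sup>+\<omega>. f (Y \<omega>, Z \<omega>) \<partial>M) = (\<integral>\<^sup>+p. f p \<partial>distr M (S \<Otimes>\<^sub>M T) (\<lambda>\<omega>. (Y \<omega>, Z \<omega>)))"
    by (subst nn_integral_distr) auto
  also have "\<dots> = (\<integral>\<^sup>+p. f p \<partial>(distr M S Y \<Otimes>\<^sub>M distr M T Z))"
    using indep by (simp add: indep_var_distribution_eq)
  also have "\<dots> = (\<integral>\<^sup>+y. (\<integral>\<^sup>+z. f (y, z) \<partial>distr M T Z) \<partial>distr M S Y)"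
    by (rule T.nn_integral_fst[symmetric]) simp
  also have "\<dots> = (\<integral>\<^sup>+\<omega>. (\<integral>\<^sup>+z. f (Y \<omega>, z) \<partial>distr M T Z) \<partial>M)"
    by (subst nn_integral_distr) auto
  also have "\<dots> = (\<integral>\<^sup>+\<omega>. (\<integral>\<^sup>+\<omega>'. f (Y \<omega>, Z \<omega>') \<partial>M) \<partial>M)"
  proof (rule nn_integral_cong)
    fix \<omega> assume "\<omega> \<in> space M"
    then have [simp]: "Y \<omega> \<in> space S" by (rule measurable_space[rotated]) measurable
    show "(\<integral>\<^sup>+z. f (Y \<omega>, z) \<partial>distr M T Z) = (\<integral>\<^sup>+\<omega>'. f (Y \<omega>, Z \<omega>') \<partial>M)"
      by (subst nn_integral_distr) auto
  qed
  finally show ?thesis .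
qed

lemma borel_measurable_vec_component [measurable]:
  "(\<lambda>x :: 'a::euclidean_space^'n. x $ i) \<in> borel_measurable borel"
  by (intro borel_measurable_continuous_onI continuous_on_component continuous_on_id)

lemma borel_measurable_complex_matrix_mult [measurable]:
  "(\<lambda>y. complex_matrix A *v y) \<in> borel_measurable borel"
  unfolding matrix_vector_mult_def
  by (intro borel_measurable_continuous_onI continuous_intros)

lemma borel_measurable_herm_prod [measurable (raw)]:
  assumes [measurable]: "f \<in> borel_measurable N" "h \<in> borel_measurable N"
  shows "(\<lambda>x. herm_prod (f x) (h x)) \<in> borel_measurable N"
proof -
  have [measurable]: "cnj \<in> borel_measurable borel"
    by (intro borel_measurable_continuous_onI continuous_intros)
  show ?thesis unfolding herm_prod_def by measurable
qed

section \<open>The network model: eigenvalues, gains and independent sources\<close>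

locale mrc_network = prob_space M for M :: "'w measure" +
  fixes lam alpha Rd SNR :: real
    and C S :: "real^'n^'n"
    and mu :: "nat \<Rightarrow> real"
    and d0 :: "'w \<Rightarrow> real"
    and X :: "nat \<Rightarrow> 'w \<Rightarrow> real^2"
    and g :: "nat \<Rightarrow> 'w \<Rightarrow> complex^'n"
  assumes lam: "lam > 0" and alpha: "alpha > 2" and Rd: "Rd > 1" and SNR: "SNR > 0"
    and C_psd: "psd_matrix C"
    and C_rank: "1 \<le> rank C"
    and C_sqrt: "is_psd_sqrt S C"
    and mu_pos: "\<And>n. n \<in> {1..rank C} \<Longrightarrow> mu n > 0"
    and mu_decreasing: "\<And>m n. 1 \<le> m \<Longrightarrow> m \<le> n \<Longrightarrow> n \<le> rank C \<Longrightarrow> mu n \<le> mu m"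
    and mu_eigenvalues:
      "\<And>x. x \<noteq> 0 \<Longrightarrow> card {n \<in> {1..rank C}. mu n = x} = order x (charpoly C)"
    and d0_density:
      "distributed M lborel d0 (\<lambda>r. ennreal (annulus_distance_density Rd r))"
    and interferers_PPP: "homogeneous_PPP M lam X"
    and fading_measurable: "\<And>l. g l \<in> borel_measurable M"
    and fading_entries_indep:
      "\<And>l. indep_vars (\<lambda>_. borel) (\<lambda>i \<omega>. g l \<omega> $ i) (UNIV :: 'n set)"
    and fading_entries_normal:
      "\<And>l i. distributed M lborel (\<lambda>\<omega>. g l \<omega> $ i)
                 (\<lambda>z. ennreal (std_complex_normal_density z))"
    and sources_indep:
      "indep_sets (\<lambda>s. sets (source_algebra M d0 X g s)) UNIV"
begin

lemma mu1_pos: "mu 1 > 0"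
  using mu_pos C_rank by simp

lemma d0_measurable [measurable]: "d0 \<in> borel_measurable M"
  using distributed_measurable[OF d0_density] by simp

lemma X_measurable [measurable]: "X l \<in> borel_measurable M"
  using interferers_PPP by (simp add: homogeneous_PPP_def)

lemmas g_measurable [measurable] = fading_measurable

lemma X_sequence_measurable [measurable]: "(\<lambda>\<omega> l. X l \<omega>) \<in> measurable M (\<Pi>\<^sub>M l\<in>UNIV. borel)"
  by (rule measurable_PiM_single') auto

text \<open>Away from 0, the values d i and the list mu contain every number equally often, namely
  as often as it is a root of the characteristic polynomial. Hence no d i exceeds
  \<open>mu 1\<close>, and the products agree because d i = 0 contributes a factor 1.\<close>

lemma eigenbasis:
  obtains Q :: "'n \<Rightarrow> real^'n" and d where
    "\<And>i j. Q i \<bullet> Q j = (if i = j then 1 else 0)" "\<And>i. C *v Q i = d i *\<^sub>R Q i"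
    "\<And>i. d i \<ge> 0" "\<And>i. d i \<le> mu 1"
    "\<And>s. (\<Prod>i\<in>UNIV. 1 / (1 + s * d i)) = (\<Prod>n = 1..rank C. 1 / (1 + mu n * s))"
proof -
  have "transpose C = C" using C_psd by (simp add: psd_matrix_def)
  from symmetric_matrix_diagonalization[OF this] obtain Q :: "'n \<Rightarrow> real^'n" and d where
    Q: "\<And>i j. Q i \<bullet> Q j = (if i = j then 1 else 0)" and C: "\<And>i. C *v Q i = d i *\<^sub>R Q i"
    by blast
  have card: "card {i\<in>UNIV. d i = x} = card {n \<in> {1..rank C}. mu n = x}" if "x \<noteq> 0" for x
    using mu_eigenvalues[OF that] by (simp add: charpoly_eq_prod[OF Q C] order_prod_linear)
  have "d i \<ge> 0" for i
  proof -
    have "0 \<le> Q i \<bullet> (C *v Q i)" using C_psd by (simp add: psd_matrix_def)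
    then show ?thesis by (simp add: C Q)
  qed
  moreover have "d i \<le> mu 1" for i
  proof (cases "d i = 0")
    case False
    have "card {j\<in>UNIV. d j = d i} \<noteq> 0" by auto
    then have "{n \<in> {1..rank C}. mu n = d i} \<noteq> {}"
      unfolding card[OF False] by (metis card.empty)
    then show ?thesis using mu_decreasing[of 1] by force
  qed (use mu1_pos in simp)
  moreover have "(\<Prod>i\<in>UNIV. 1 / (1 + s * d i)) = (\<Prod>n = 1..rank C. 1 / (1 + mu n * s))" for s
    using prod_eq_if_card_eq[of UNIV "{1..rank C}" 0 d mu "\<lambda>x. 1 / (1 + s * x)"] card
    by (simp add: mult.commute)
  ultimately show ?thesis using that Q C by blast
qed

lemma signal_gain_laplace:
  assumes "s \<ge> 0"
  shows "(\<integral>\<^sup>+\<omega>. ennreal (exp (- (s * signal_gain S g \<omega>))) \<partial>M)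
    = ennreal (\<Prod>n = 1..rank C. 1 / (1 + mu n * s))"
proof -
  obtain Q :: "'n \<Rightarrow> real^'n" and d where *:
    "\<And>i j. Q i \<bullet> Q j = (if i = j then 1 else 0)" "\<And>i. C *v Q i = d i *\<^sub>R Q i"
    "\<And>i. d i \<ge> 0" "\<And>i. d i \<le> mu 1"
    "\<And>s. (\<Prod>i\<in>UNIV. 1 / (1 + s * d i)) = (\<Prod>n = 1..rank C. 1 / (1 + mu n * s))"
    by (rule eigenbasis) blast
  show ?thesis
    using std_complex_normal_psd_sqrt_laplace[OF fading_measurable[of 0] fading_entries_indep
        fading_entries_normal C_sqrt *(1,2,3) assms]
    by (simp only: *(5) signal_gain_def fading_def)
qed

lemma interferer_gain_laplace:
  assumes "s \<ge> 0"
  shows "ennreal (1 / (1 + s * mu 1))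
    \<le> (\<integral>\<^sup>+\<omega>. ennreal (exp (- (s * ((cmod (herm_prod h (complex_matrix S *v g l \<omega>)))\<^sup>2 / (norm h)\<^sup>2)))) \<partial>M)"
proof -
  obtain Q :: "'n \<Rightarrow> real^'n" and d where *:
    "\<And>i j. Q i \<bullet> Q j = (if i = j then 1 else 0)" "\<And>i. C *v Q i = d i *\<^sub>R Q i"
    "\<And>i. d i \<ge> 0" "\<And>i. d i \<le> mu 1"
    by (rule eigenbasis) blast
  show ?thesis
    by (rule std_complex_normal_interferer_laplace[OF fading_measurable fading_entries_indep
        fading_entries_normal C_sqrt *(1,2,4)]) (use mu1_pos assms in auto)
qed

text \<open>Library independence requires all variables to have the same type. The identity map into each
  source sigma algebra achieves this; the actual variables are recovered by composition.\<close>

lemma indep_vars_sources: "indep_vars (\<lambda>s. source_algebra M d0 X g s) (\<lambda>s \<omega>. \<omega>) UNIV"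
proof -
  have rv: "(\<lambda>\<omega>. \<omega>) \<in> measurable M (source_algebra M d0 X g s)" for s
  proof (cases s)
    case Interferers
    show ?thesis unfolding Interferers source_algebra.simps
      by (rule measurable_vimage_algebra2) (simp_all add: X_sequence_measurable)
  qed (simp_all add: measurable_vimage_algebra2)
  have "{(\<lambda>\<omega>. \<omega>) -` A \<inter> space M | A. A \<in> sets (source_algebra M d0 X g s)}
      = sets (source_algebra M d0 X g s)" for s
  proof -
    have "space (source_algebra M d0 X g s) = space M" by (cases s) auto
    then have A: "(\<lambda>\<omega>. \<omega>) -` A \<inter> space M = A" if "A \<in> sets (source_algebra M d0 X g s)" for A
      using sets.sets_into_space[OF that] by auto
    show ?thesis
    proof (intro set_eqI iffI)
      fix B assume "B \<in> sets (source_algebra M d0 X g s)"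
      with A[OF this] show "B \<in> {(\<lambda>\<omega>. \<omega>) -` A \<inter> space M | A. A \<in> sets (source_algebra M d0 X g s)}"
        by (metis (mono_tags, lifting) mem_Collect_eq)
    next
      fix B assume "B \<in> {(\<lambda>\<omega>. \<omega>) -` A \<inter> space M | A. A \<in> sets (source_algebra M d0 X g s)}"
      then obtain A' where "B = (\<lambda>\<omega>. \<omega>) -` A' \<inter> space M" "A' \<in> sets (source_algebra M d0 X g s)"
        by blast
      with A show "B \<in> sets (source_algebra M d0 X g s)" by metis
    qed
  qed
  then show ?thesis
    unfolding indep_vars_def2 using rv sources_indep by simp
qed

text \<open>A point w of the product space gives each source a sample point of its own. Each network
  quantity reads only its own coordinate, so it is measurable for the product of the source sigma
  algebras.\<close>

lemma measurable_direct_distance: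
  "Direct_Distance \<in> A \<Longrightarrow> (\<lambda>w. d0 (w Direct_Distance)) \<in> borel_measurable (Pi\<^sub>M A (source_algebra M d0 X g))"
  by (rule measurable_compose[OF measurable_component_singleton]) (auto intro!: measurable_vimage_algebra1)

lemma measurable_interferers:
  "Interferers \<in> A \<Longrightarrow> (\<lambda>w l. X l (w Interferers)) \<in> measurable (Pi\<^sub>M A (source_algebra M d0 X g)) (\<Pi>\<^sub>M l\<in>UNIV. borel)"
  by (rule measurable_compose[OF measurable_component_singleton])
    (auto intro!: measurable_vimage_algebra1 simp: space_PiM)

lemma measurable_fading:
  "Fading l \<in> A \<Longrightarrow> (\<lambda>w. g l (w (Fading l))) \<in> borel_measurable (Pi\<^sub>M A (source_algebra M d0 X g))"
  by (rule measurable_compose[OF measurable_component_singleton]) (auto intro!: measurable_vimage_algebra1)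

lemma nn_integral_indep_sources:
  assumes AB: "A \<inter> B = {}"
    and [measurable]: "Y \<in> measurable (Pi\<^sub>M A (source_algebra M d0 X g)) T"
      "Z \<in> measurable (Pi\<^sub>M B (source_algebra M d0 X g)) U" "f \<in> borel_measurable (T \<Otimes>\<^sub>M U)"
  shows "(\<integral>\<^sup>+\<omega>. f (Y (\<lambda>s\<in>A. \<omega>), Z (\<lambda>s\<in>B. \<omega>)) \<partial>M)
    = (\<integral>\<^sup>+\<omega>. (\<integral>\<^sup>+\<omega>'. f (Y (\<lambda>s\<in>A. \<omega>), Z (\<lambda>s\<in>B. \<omega>')) \<partial>M) \<partial>M)"
proof -
  have "indep_var (Pi\<^sub>M A (source_algebra M d0 X g)) (\<lambda>\<omega>. \<lambda>s\<in>A. \<omega>)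
      (Pi\<^sub>M B (source_algebra M d0 X g)) (\<lambda>\<omega>. \<lambda>s\<in>B. \<omega>)"
    by (rule indep_var_restrict[OF indep_vars_sources AB]) auto
  from nn_integral_indep_var[OF this, of "\<lambda>(y, z). f (Y y, Z z)"] show ?thesis by simp
qed

lemma nn_integral_distance_fading:
  assumes "f \<in> borel_measurable (borel \<Otimes>\<^sub>M borel)"
  shows "(\<integral>\<^sup>+\<omega>. f (d0 \<omega>, g 0 \<omega>) \<partial>M) = (\<integral>\<^sup>+\<omega>. (\<integral>\<^sup>+\<omega>'. f (d0 \<omega>, g 0 \<omega>') \<partial>M) \<partial>M)"
  using nn_integral_indep_sources[OF _ measurable_direct_distance[of "{Direct_Distance}"]
      measurable_fading[of 0 "{Fading 0}"] assms]
  by simp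

lemma nn_integral_link_interferers:
  assumes "f \<in> borel_measurable ((borel \<Otimes>\<^sub>M borel) \<Otimes>\<^sub>M (\<Pi>\<^sub>M l\<in>UNIV. borel))"
  shows "(\<integral>\<^sup>+\<omega>. f ((d0 \<omega>, g 0 \<omega>), \<lambda>l. X l \<omega>) \<partial>M)
    = (\<integral>\<^sup>+\<omega>. (\<integral>\<^sup>+\<omega>'. f ((d0 \<omega>, g 0 \<omega>), \<lambda>l. X l \<omega>') \<partial>M) \<partial>M)"
  using nn_integral_indep_sources[OF _ measurable_Pair[OF
        measurable_direct_distance[of "{Direct_Distance, Fading 0}"] measurable_fading[of 0]]
      measurable_interferers[of "{Interferers}"] assms]
  by simp

lemma nn_integral_link_fading:
  assumes "f \<in> borel_measurable (((borel \<Otimes>\<^sub>M borel) \<Otimes>\<^sub>M (\<Pi>\<^sub>M l\<in>UNIV. borel)) \<Otimes>\<^sub>M (\<Pi>\<^sub>M l\<in>UNIV. borel))"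
  shows "(\<integral>\<^sup>+\<omega>. f (((d0 \<omega>, g 0 \<omega>), \<lambda>l. X l \<omega>), \<lambda>l. g (Suc l) \<omega>) \<partial>M)
    = (\<integral>\<^sup>+\<omega>. (\<integral>\<^sup>+\<omega>'. f (((d0 \<omega>, g 0 \<omega>), \<lambda>l. X l \<omega>), \<lambda>l. g (Suc l) \<omega>') \<partial>M) \<partial>M)"
proof -
  let ?A = "{Direct_Distance, Fading 0, Interferers}" and ?B = "range (\<lambda>l. Fading (Suc l))"
  have Z: "(\<lambda>w l. g (Suc l) (w (Fading (Suc l)))) \<in> measurable (Pi\<^sub>M ?B (source_algebra M d0 X g)) (\<Pi>\<^sub>M l\<in>UNIV. borel)"
    by (rule measurable_PiM_single') (auto intro!: measurable_fading simp: space_PiM)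
  have Y: "(\<lambda>w. ((d0 (w Direct_Distance), g 0 (w (Fading 0))), \<lambda>l. X l (w Interferers)))
      \<in> measurable (Pi\<^sub>M ?A (source_algebra M d0 X g)) ((borel \<Otimes>\<^sub>M borel) \<Otimes>\<^sub>M (\<Pi>\<^sub>M l\<in>UNIV. borel))"
    by (intro measurable_Pair measurable_direct_distance measurable_fading measurable_interferers) auto
  show ?thesis
    using nn_integral_indep_sources[OF _ Y Z assms] by auto
qed

lemma nn_integral_prod_fading:
  fixes F :: "nat \<Rightarrow> complex^'n \<Rightarrow> ennreal"
  assumes F[measurable]: "\<And>l. F l \<in> borel_measurable borel"
  shows "(\<integral>\<^sup>+\<omega>. (\<Prod>l<N. F l (g (Suc l) \<omega>)) \<partial>M) = (\<Prod>l<N. \<integral>\<^sup>+\<omega>. F l (g (Suc l) \<omega>) \<partial>M)"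
proof -
  \<comment> \<open>The source \<open>Fading (Suc l)\<close> carries the factor F l, so
    \<open>l - 1\<close> undoes the shift. The value 1 elsewhere is a filler.\<close>
  define G where "G s \<omega> = (case s of Fading l \<Rightarrow> F (l - 1) (g l \<omega>) | _ \<Rightarrow> 1)" for s \<omega>
  have inj: "inj_on (\<lambda>l. Fading (Suc l)) {..<N}" by (auto simp: inj_on_def)
  have "indep_vars (\<lambda>_. borel) G ((\<lambda>l. Fading (Suc l)) ` {..<N})"
    unfolding G_def[abs_def]
  proof (rule indep_vars_compose2[OF indep_vars_subset[OF indep_vars_sources]])
    fix s assume "s \<in> (\<lambda>l. Fading (Suc l)) ` {..<N}"
    then obtain l where s: "s = Fading (Suc l)" by blast
    have "g (Suc l) \<in> borel_measurable (source_algebra M d0 X g s)"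
      by (auto simp: s intro!: measurable_vimage_algebra1)
    then show "(\<lambda>\<omega>. case s of Fading l \<Rightarrow> F (l - 1) (g l \<omega>) | _ \<Rightarrow> 1) \<in> borel_measurable (source_algebra M d0 X g s)"
      by (simp add: s) 
  qed simp
  from indep_vars_nn_integral[OF _ this] show ?thesis
    by (simp add: prod.reindex[OF inj] G_def)
qed

end

subsection \<open>Interference\<close>

text \<open>If f is not integrable the left side is 0. The iterated integral of the lower bound can
  thus be estimated without any proof of integrability.\<close>

lemma ennreal_integral_le_nn_integral:
  assumes "\<And>x. 0 \<le> f x"
  shows "ennreal (integral\<^sup>L N f) \<le> (\<integral>\<^sup>+x. ennreal (f x) \<partial>N)"
proof (cases "integrable N f")
  case True
  then show ?thesis using assms by (simp add: nn_integral_eq_integral)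
qed (simp add: not_integrable_integral_eq)

lemma exp_neg_partial_sums_tendsto_0:
  fixes f :: "nat \<Rightarrow> real"
  assumes f: "\<And>n. 0 \<le> f n" and "\<not> summable f" and z: "z > 0"
  shows "(\<lambda>n. exp (- (z * (\<Sum>i<n. f i)))) \<longlonglongrightarrow> 0"
proof -
  have "filterlim (\<lambda>n. \<Sum>i<n. f i) at_top sequentially"
    unfolding filterlim_at_top
  proof
    fix B
    obtain m where m: "B < (\<Sum>i<m. f i)"
      using assms(2) summableI_nonneg_bounded[OF f, where x=B] by (meson not_le)
    have "B \<le> (\<Sum>i<n. f i)" if "m \<le> n" for n
      using m sum_mono2[of "{..<n}" "{..<m}" f] that f by fastforce
    then show "eventually (\<lambda>n. B \<le> (\<Sum>i<n. f i)) sequentially"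
      unfolding eventually_sequentially by blast
  qed
  then have "filterlim (\<lambda>n. z * (\<Sum>i<n. f i)) at_top sequentially"
    by (rule filterlim_tendsto_pos_mult_at_top[OF tendsto_const z])
  then have "filterlim (\<lambda>n. - (z * (\<Sum>i<n. f i))) at_bot sequentially"
    by (simp add: filterlim_uminus_at_bot)
  then show ?thesis by (rule filterlim_compose[OF exp_at_bot])
qed

text \<open>Both steps use 1 + x <= exp x: 1 - sum a <= exp (- sum a), and exp (- a) <= 1 / (1 + a)
  in each factor. It provides the bound linear in z that cancels 1 / z. For infinite I both sides
  are 0.\<close>

lemma one_minus_prod_inverse_le:
  fixes a :: "'i \<Rightarrow> real"
  assumes "\<And>i. i \<in> I \<Longrightarrow> 0 \<le> a i"
  shows "1 - (\<Prod>i\<in>I. 1 / (1 + a i)) \<le> sum a I"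
proof (cases "finite I")
  case True
  have "1 - sum a I \<le> exp (- sum a I)"
    using exp_ge_add_one_self[of "- sum a I"] by simp
  also have "\<dots> = (\<Prod>i\<in>I. exp (- a i))"
    using True by (simp add: exp_sum[symmetric] sum_negf)
  also have "\<dots> \<le> (\<Prod>i\<in>I. 1 / (1 + a i))"
  proof (rule prod_mono, safe)
    fix i assume "i \<in> I"
    then have "0 < 1 + a i" "1 + a i \<le> exp (a i)" using assms[of i] by (auto simp: add_pos_nonneg)
    then show "exp (- a i) \<le> 1 / (1 + a i)" by (simp add: exp_minus field_simps)
  qed simp
  finally show ?thesis by simp
qed simp

lemma prod_inverse_le_1:
  fixes a :: "'i \<Rightarrow> real"
  assumes "\<And>i. i \<in> I \<Longrightarrow> 0 \<le> a i"
  shows "(\<Prod>i\<in>I. 1 / (1 + a i)) \<le> 1"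
proof (rule prod_le_1)
  fix i assume "i \<in> I"
  with assms have "0 \<le> a i" by blast
  then show "0 \<le> 1 / (1 + a i) \<and> 1 / (1 + a i) \<le> 1" by (simp add: divide_le_eq)
qed

section \<open>Laplace transforms of interference and received power\<close>

context mrc_network
begin

definition path_gain :: "nat \<Rightarrow> 'w \<Rightarrow> real" where
  "path_gain l \<omega> = interferer_gain S g (Suc l) \<omega> * norm (X l \<omega>) powr (- alpha)"

text \<open>The Laplace transform at z that the interference would have if all gains were
  independent exponential variables with mean \<open>mu 1\<close>.\<close>

definition laplace_bound :: "real \<Rightarrow> real" where
  "laplace_bound z = exp (- lam * ((z * mu 1) powr (2 / alpha) * pi / nsinc (2 / alpha)))"

text \<open>The mean of \<open>1 - exp (- z a)\<close>, where a is the received power at link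
  distance x.\<close>

definition rank_factor :: "real \<Rightarrow> real \<Rightarrow> real" where
  "rank_factor z x = 1 - (\<Prod>n = 1..rank C. 1 / (1 + mu n * z * x powr (- alpha)))"

definition received_power :: "'w \<Rightarrow> real" where
  "received_power \<omega> = signal_gain S g \<omega> * d0 \<omega> powr (- alpha)"

lemma path_gain_nonneg: "0 \<le> path_gain l \<omega>"
  by (simp add: path_gain_def interferer_gain_def)

lemma path_gain_measurable [measurable]: "path_gain l \<in> borel_measurable M"
  unfolding path_gain_def[abs_def] interferer_gain_def fading_def by measurable

lemma interference_eq: "interference alpha S X g \<omega> = (\<Sum>l. path_gain l \<omega>)"
  by (simp add: interference_def path_gain_def)

lemma received_power_nonneg: "0 \<le> received_power \<omega>"
  by (simp add: received_power_def signal_gain_def)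

lemma received_power_measurable [measurable]: "received_power \<in> borel_measurable M"
  unfolding received_power_def[abs_def] signal_gain_def fading_def by measurable

lemma nsinc_pos: "nsinc (2 / alpha) > 0"
  using alpha unfolding nsinc_def by (intro divide_pos_pos sin_gt_zero) (auto simp: field_simps)

lemma interferer_laplace_ge:
  assumes z: "z > 0"
  shows "ennreal (laplace_bound z)
    \<le> (\<integral>\<^sup>+\<omega>. ennreal (\<Prod>l<N. 1 / (1 + z * norm (X l \<omega>) powr (- alpha) * mu 1)) \<partial>M)"
proof -
  define k where "k = z * mu 1"
  have k: "k > 0" using z mu1_pos by (simp add: k_def)
  \<comment> \<open>Chosen so that exp (- f y) is the Laplace transform of the contribution of one
    interferer at y whose gain is exponential with mean \<open>mu 1\<close>.\<close>
  define f where "f y = ln (1 + k * norm y powr (- alpha))" for y :: "real^2"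
  have pos: "1 + k * norm y powr (- alpha) > 0" for y :: "real^2"
    using k by (intro add_pos_nonneg) auto
  have [measurable]: "f \<in> borel_measurable borel" unfolding f_def[abs_def] by measurable
  have e: "exp (- f y) = 1 / (1 + z * norm y powr (- alpha) * mu 1)" for y
    using pos[of y] by (simp add: f_def exp_minus k_def field_simps)
  have "ennreal (exp (- lam * (k powr (2 / alpha) * pi / nsinc (2 / alpha))))
    \<le> (\<integral>\<^sup>+\<omega>. ennreal (\<Prod>l<N. exp (- f (X l \<omega>))) \<partial>M)"
  proof (rule homogeneous_PPP_laplace_ge[OF prob_space_axioms interferers_PPP])
    show "0 \<le> f y" for y using k by (simp add: f_def)
    have "(\<integral>\<^sup>+y. ennreal (1 - exp (- f y)) \<partial>lborel)
      = (\<integral>\<^sup>+y. ennreal (k * norm y powr (- alpha) / (1 + k * norm y powr (- alpha))) \<partial>(lborel :: (real^2) measure))"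
    proof (intro nn_integral_cong arg_cong[where f=ennreal])
      fix y :: "real^2"
      show "1 - exp (- f y) = k * norm y powr (- alpha) / (1 + k * norm y powr (- alpha))"
        using pos[of y] by (simp add: f_def exp_minus field_simps)
    qed
    also have "\<dots> \<le> ennreal (k powr (2 / alpha) * pi / nsinc (2 / alpha))"
      by (rule nn_integral_path_loss[OF alpha k])
    finally show "(\<integral>\<^sup>+y. ennreal (1 - exp (- f y)) \<partial>lborel) \<le> ennreal (k powr (2 / alpha) * pi / nsinc (2 / alpha))" .
  qed (use lam nsinc_pos in \<open>auto intro!: mult_nonneg_nonneg divide_nonneg_nonneg\<close>)
  then show ?thesis by (simp only: e laplace_bound_def k_def)
qed

text \<open>W is an arbitrary weight depending on the direct link, later the constant 1 and the
  signal factor. The conditional bound does not involve the link, so it can be pulled out of the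
  expectation.\<close>

lemma laplace_partial_interference:
  fixes W :: "real \<times> (complex^'n) \<Rightarrow> ennreal"
  assumes [measurable]: "W \<in> borel_measurable (borel \<Otimes>\<^sub>M borel)" and z: "z > 0"
  shows "(\<integral>\<^sup>+\<omega>. W (d0 \<omega>, g 0 \<omega>) \<partial>M) * ennreal (laplace_bound z)
    \<le> (\<integral>\<^sup>+\<omega>. W (d0 \<omega>, g 0 \<omega>) * ennreal (exp (- (z * (\<Sum>l<N. path_gain l \<omega>)))) \<partial>M)"
proof -
  define F :: "(real \<times> (complex^'n)) \<times> (nat \<Rightarrow> real^2) \<Rightarrow> nat \<Rightarrow> complex^'n \<Rightarrow> ennreal" where
    "F p l y = ennreal (exp (- (z * norm (snd p l) powr (- alpha) *
      ((cmod (herm_prod (complex_matrix S *v snd (fst p)) (complex_matrix S *v y)))\<^sup>2 /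
        (norm (complex_matrix S *v snd (fst p)))\<^sup>2))))" for p l y
  define R :: "(nat \<Rightarrow> real^2) \<Rightarrow> ennreal" where
    "R x = ennreal (\<Prod>l<N. 1 / (1 + z * norm (x l) powr (- alpha) * mu 1))" for x
  have [measurable]: "R \<in> borel_measurable (\<Pi>\<^sub>M l\<in>UNIV. borel)"
    unfolding R_def[abs_def] by measurable
  have "(\<integral>\<^sup>+\<omega>. W (d0 \<omega>, g 0 \<omega>) \<partial>M) * ennreal (laplace_bound z)
    = (\<integral>\<^sup>+\<omega>. W (d0 \<omega>, g 0 \<omega>) * ennreal (laplace_bound z) \<partial>M)"
    by (rule nn_integral_multc[symmetric]) measurable
  also have "\<dots> \<le> (\<integral>\<^sup>+\<omega>. W (d0 \<omega>, g 0 \<omega>) * (\<integral>\<^sup>+\<omega>'. R (\<lambda>l. X l \<omega>') \<partial>M) \<partial>M)"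
    unfolding R_def by (intro nn_integral_mono mult_left_mono interferer_laplace_ge z) simp
  also have "\<dots> = (\<integral>\<^sup>+\<omega>. (\<integral>\<^sup>+\<omega>'. W (d0 \<omega>, g 0 \<omega>) * R (\<lambda>l. X l \<omega>') \<partial>M) \<partial>M)"
    by (intro nn_integral_cong nn_integral_cmult[symmetric]) measurable
  also have "\<dots> = (\<integral>\<^sup>+\<omega>. W (d0 \<omega>, g 0 \<omega>) * R (\<lambda>l. X l \<omega>) \<partial>M)"
    using nn_integral_link_interferers[of "\<lambda>(y, x). W y * R x"] by simp
  also have "\<dots> \<le> (\<integral>\<^sup>+\<omega>. (\<integral>\<^sup>+\<omega>'. W (d0 \<omega>, g 0 \<omega>) * (\<Prod>l<N. F ((d0 \<omega>, g 0 \<omega>), \<lambda>l. X l \<omega>) l (g (Suc l) \<omega>')) \<partial>M) \<partial>M)"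
  proof (rule nn_integral_mono)
    fix \<omega>
    let ?p = "((d0 \<omega>, g 0 \<omega>), \<lambda>l. X l \<omega>)"
    have [measurable]: "F ?p l \<in> borel_measurable borel" for l
      unfolding F_def by measurable
    have "R (\<lambda>l. X l \<omega>) = (\<Prod>l<N. ennreal (1 / (1 + z * norm (X l \<omega>) powr (- alpha) * mu 1)))"
      unfolding R_def using z mu1_pos
      by (intro prod_ennreal[symmetric]) (auto intro!: divide_nonneg_nonneg add_nonneg_nonneg)
    also have "\<dots> \<le> (\<Prod>l<N. \<integral>\<^sup>+\<omega>'. F ?p l (g (Suc l) \<omega>') \<partial>M)"
      unfolding F_def using z by (intro prod_mono_ennreal, simp only: fst_conv snd_conv)
        (intro interferer_gain_laplace, simp)
    also have "\<dots> = (\<integral>\<^sup>+\<omega>'. (\<Prod>l<N. F ?p l (g (Suc l) \<omega>')) \<partial>M)"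
      by (rule nn_integral_prod_fading[symmetric]) measurable
    finally show "W (d0 \<omega>, g 0 \<omega>) * R (\<lambda>l. X l \<omega>)
      \<le> (\<integral>\<^sup>+\<omega>'. W (d0 \<omega>, g 0 \<omega>) * (\<Prod>l<N. F ?p l (g (Suc l) \<omega>')) \<partial>M)"
      by (subst nn_integral_cmult) (auto intro: mult_left_mono)
  qed
  also have "\<dots> = (\<integral>\<^sup>+\<omega>. W (d0 \<omega>, g 0 \<omega>) * (\<Prod>l<N. F ((d0 \<omega>, g 0 \<omega>), \<lambda>l. X l \<omega>) l (g (Suc l) \<omega>)) \<partial>M)"
  proof -
    have "(\<lambda>(p, y). W (fst p) * (\<Prod>l<N. F p l (y l)))
      \<in> borel_measurable (((borel \<Otimes>\<^sub>M borel) \<Otimes>\<^sub>M (\<Pi>\<^sub>M l\<in>UNIV. borel)) \<Otimes>\<^sub>M (\<Pi>\<^sub>M l\<in>UNIV. borel))"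
      unfolding F_def by measurable
    from nn_integral_link_fading[OF this] show ?thesis by simp
  qed
  also have "\<dots> = (\<integral>\<^sup>+\<omega>. W (d0 \<omega>, g 0 \<omega>) * ennreal (exp (- (z * (\<Sum>l<N. path_gain l \<omega>)))) \<partial>M)"
    by (intro nn_integral_cong)
      (simp add: F_def prod_ennreal exp_sum[symmetric] path_gain_def interferer_gain_def fading_def
        sum_negf sum_distrib_left mult_ac)
  finally show ?thesis .
qed

text \<open>The sequence of arguments is chosen so that its power 2 / \<alpha> is 1 / (n + 1), which
  makes the exponent linear in that quantity.\<close>

lemma laplace_bound_tendsto_1: "(\<lambda>n. laplace_bound ((1 / real (Suc n)) powr (alpha / 2))) \<longlonglongrightarrow> 1"
proof -
  define c where "c = lam * (mu 1 powr (2 / alpha) * pi / nsinc (2 / alpha))"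
  have "laplace_bound ((1 / real (Suc n)) powr (alpha / 2)) = exp (- c * (1 / real (Suc n)))" for n
  proof -
    have "((1 / real (Suc n)) powr (alpha / 2) * mu 1) powr (2 / alpha)
        = 1 / real (Suc n) * mu 1 powr (2 / alpha)"
      using alpha mu1_pos by (simp add: powr_mult powr_powr)
    then show ?thesis by (simp add: laplace_bound_def c_def)
  qed
  moreover have "(\<lambda>n. exp (- c * (1 / real (Suc n)))) \<longlonglongrightarrow> exp (- c * 0)"
    by (intro tendsto_intros LIMSEQ_inverse_real_of_nat[unfolded inverse_eq_divide])
  ultimately show ?thesis by simp
qed

text \<open>\<open>exp (- z I)\<close> vanishes where the series \<open>I\<close> diverges, hence \<open>laplace_bound z \<le> P(I < \<infinity>)\<close>; let \<open>z\<close> tend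
  to \<open>0\<close>.\<close>

lemma AE_summable_path_gain: "AE \<omega> in M. summable (\<lambda>l. path_gain l \<omega>)"
proof -
  \<comment> \<open>The sum in \<open>ennreal\<close> always exists and is measurable, so the event
    of convergence is measurable.\<close>
  define T where "T \<omega> = (\<Sum>l. ennreal (path_gain l \<omega>))" for \<omega>
  have [measurable]: "T \<in> borel_measurable M" unfolding T_def[abs_def] by measurable
  have T: "T \<omega> \<noteq> top \<longleftrightarrow> summable (\<lambda>l. path_gain l \<omega>)" for \<omega>
  proof
    show "T \<omega> \<noteq> top \<Longrightarrow> summable (\<lambda>l. path_gain l \<omega>)"
      unfolding T_def by (rule summable_suminf_not_top[OF path_gain_nonneg])
    assume "summable (\<lambda>l. path_gain l \<omega>)"
    from suminf_ennreal2[OF path_gain_nonneg this] show "T \<omega> \<noteq> top" by (simp add: T_def)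
  qed
  let ?E = "{\<omega>\<in>space M. T \<omega> \<noteq> top}"
  have E: "?E \<in> sets M" by measurable
  have bound: "ennreal (laplace_bound z) \<le> emeasure M ?E" if z: "z > 0" for z
  proof -
    define L where "L \<omega> = (if T \<omega> \<noteq> top then ennreal (exp (- (z * (\<Sum>l. path_gain l \<omega>)))) else 0)" for \<omega>
    have lim: "(\<lambda>N. \<integral>\<^sup>+\<omega>. ennreal (exp (- (z * (\<Sum>l<N. path_gain l \<omega>)))) \<partial>M) \<longlonglongrightarrow> (\<integral>\<^sup>+\<omega>. L \<omega> \<partial>M)"
    proof (rule nn_integral_dominated_convergence[where w="\<lambda>_. 1"])
      show "L \<in> borel_measurable M" unfolding L_def[abs_def] by measurable
      show "AE \<omega> in M. (\<lambda>N. ennreal (exp (- (z * (\<Sum>l<N. path_gain l \<omega>))))) \<longlonglongrightarrow> L \<omega>"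
      proof (rule AE_I2)
        fix \<omega>
        show "(\<lambda>N. ennreal (exp (- (z * (\<Sum>l<N. path_gain l \<omega>))))) \<longlonglongrightarrow> L \<omega>"
        proof (cases "T \<omega> = top")
          case True
          then have "\<not> summable (\<lambda>l. path_gain l \<omega>)" using T[of \<omega>] by blast
          from tendsto_ennrealI[OF exp_neg_partial_sums_tendsto_0[OF path_gain_nonneg this z]] True
          show ?thesis by (simp add: L_def)
        next
          case False
          then have sm: "summable (\<lambda>l. path_gain l \<omega>)" using T[of \<omega>] by blast
          have "(\<lambda>N. ennreal (exp (- (z * (\<Sum>l<N. path_gain l \<omega>)))))
              \<longlonglongrightarrow> ennreal (exp (- (z * (\<Sum>l. path_gain l \<omega>))))"
            by (intro tendsto_ennrealI tendsto_exp tendsto_minus tendsto_mult_left summable_LIMSEQ[OF sm])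
          with False show ?thesis by (simp add: L_def)
        qed
      qed
      show "AE \<omega> in M. ennreal (exp (- (z * (\<Sum>l<N. path_gain l \<omega>)))) \<le> 1" for N
        using z path_gain_nonneg by (intro AE_I2) (auto simp: ennreal_le_1 intro!: mult_nonneg_nonneg sum_nonneg)
    qed (auto simp: emeasure_space_1)
    have le: "ennreal (laplace_bound z) \<le> (\<integral>\<^sup>+\<omega>. ennreal (exp (- (z * (\<Sum>l<N. path_gain l \<omega>)))) \<partial>M)" for N
      using laplace_partial_interference[of "\<lambda>_. 1" z N] z by (simp add: emeasure_space_1)
    have "ennreal (laplace_bound z) \<le> (\<integral>\<^sup>+\<omega>. L \<omega> \<partial>M)"
      by (rule LIMSEQ_le_const[OF lim]) (intro exI[of _ 0] allI impI le)
    also have "\<dots> \<le> (\<integral>\<^sup>+\<omega>. indicator ?E \<omega> \<partial>M)"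
    proof (rule nn_integral_mono)
      fix \<omega> assume \<omega>: "\<omega> \<in> space M"
      show "L \<omega> \<le> indicator ?E \<omega>"
      proof (cases "T \<omega> = top")
        case False
        then have "summable (\<lambda>l. path_gain l \<omega>)" using T[of \<omega>] by blast
        then have "0 \<le> z * (\<Sum>l. path_gain l \<omega>)"
          using z by (intro mult_nonneg_nonneg suminf_nonneg path_gain_nonneg) auto
        then show ?thesis using \<omega> False by (simp add: L_def ennreal_le_1)
      qed (simp add: L_def)
    qed
    also have "\<dots> = emeasure M ?E" using E by simp
    finally show ?thesis .
  qed
  have "1 \<le> prob ?E"
  proof (rule LIMSEQ_le_const2[OF laplace_bound_tendsto_1])
    have "laplace_bound ((1 / real (Suc n)) powr (alpha / 2)) \<le> prob ?E" for n
      using bound[of "(1 / real (Suc n)) powr (alpha / 2)"] by (simp add: emeasure_eq_measure)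
    then show "\<exists>N. \<forall>n\<ge>N. laplace_bound ((1 / real (Suc n)) powr (alpha / 2)) \<le> prob ?E"
      by (intro exI[of _ 0] allI impI)
  qed
  then have "prob ?E = 1" using prob_le_1[of ?E] by simp
  then have "AE \<omega> in M. \<omega> \<in> ?E" by (rule AE_prob_1)
  then show ?thesis by eventually_elim (use T in auto)
qed

text \<open>Since the series converges almost surely, the partial sums tend to the real-valued
  \<open>interference\<close>; W <= 1 supplies the dominating constant.\<close>

lemma laplace_interference:
  fixes W :: "real \<times> (complex^'n) \<Rightarrow> ennreal"
  assumes W[measurable]: "W \<in> borel_measurable (borel \<Otimes>\<^sub>M borel)" and W1: "\<And>p. W p \<le> 1" and z: "z > 0"
  shows "(\<integral>\<^sup>+\<omega>. W (d0 \<omega>, g 0 \<omega>) \<partial>M) * ennreal (laplace_bound z)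
    \<le> (\<integral>\<^sup>+\<omega>. W (d0 \<omega>, g 0 \<omega>) * ennreal (exp (- (z * interference alpha S X g \<omega>))) \<partial>M)"
proof (rule LIMSEQ_le_const)
  show "(\<lambda>N. \<integral>\<^sup>+\<omega>. W (d0 \<omega>, g 0 \<omega>) * ennreal (exp (- (z * (\<Sum>l<N. path_gain l \<omega>)))) \<partial>M)
    \<longlonglongrightarrow> (\<integral>\<^sup>+\<omega>. W (d0 \<omega>, g 0 \<omega>) * ennreal (exp (- (z * interference alpha S X g \<omega>))) \<partial>M)"
  proof (rule nn_integral_dominated_convergence[where w="\<lambda>_. 1"])
    show "AE \<omega> in M. (\<lambda>N. W (d0 \<omega>, g 0 \<omega>) * ennreal (exp (- (z * (\<Sum>l<N. path_gain l \<omega>)))))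
        \<longlonglongrightarrow> W (d0 \<omega>, g 0 \<omega>) * ennreal (exp (- (z * interference alpha S X g \<omega>)))"
      using AE_summable_path_gain
    proof eventually_elim
      fix \<omega> assume "summable (\<lambda>l. path_gain l \<omega>)"
      then show "(\<lambda>N. W (d0 \<omega>, g 0 \<omega>) * ennreal (exp (- (z * (\<Sum>l<N. path_gain l \<omega>)))))
        \<longlonglongrightarrow> W (d0 \<omega>, g 0 \<omega>) * ennreal (exp (- (z * interference alpha S X g \<omega>)))"
        unfolding interference_eq
        by (intro ennreal_tendsto_cmult tendsto_ennrealI tendsto_exp tendsto_minus tendsto_mult
            tendsto_const summable_LIMSEQ) (use le_less_trans[OF W1] in simp)
    qed
    show "AE \<omega> in M. W (d0 \<omega>, g 0 \<omega>) * ennreal (exp (- (z * (\<Sum>l<N. path_gain l \<omega>)))) \<le> 1" for N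
    proof (rule AE_I2)
      fix \<omega>
      have "ennreal (exp (- (z * (\<Sum>l<N. path_gain l \<omega>)))) \<le> 1"
        using z path_gain_nonneg by (auto simp: ennreal_le_1 intro!: mult_nonneg_nonneg sum_nonneg)
      with W1[of "(d0 \<omega>, g 0 \<omega>)"] show "W (d0 \<omega>, g 0 \<omega>) * ennreal (exp (- (z * (\<Sum>l<N. path_gain l \<omega>)))) \<le> 1"
        using mult_mono[of "W (d0 \<omega>, g 0 \<omega>)" 1 _ 1] by simp
    qed
  qed (auto simp: emeasure_space_1 interference_eq)
  show "\<exists>N. \<forall>n\<ge>N. (\<integral>\<^sup>+\<omega>. W (d0 \<omega>, g 0 \<omega>) \<partial>M) * ennreal (laplace_bound z)
      \<le> (\<integral>\<^sup>+\<omega>. W (d0 \<omega>, g 0 \<omega>) * ennreal (exp (- (z * (\<Sum>l<n. path_gain l \<omega>)))) \<partial>M)"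
    using laplace_partial_interference[OF W z] by blast
qed

lemma rank_factor_bounds:
  assumes "z \<ge> 0"
  shows "0 \<le> rank_factor z x" "rank_factor z x \<le> (\<Sum>n = 1..rank C. mu n * z * x powr (- alpha))"
proof -
  have nonneg: "0 \<le> mu n * z * x powr (- alpha)" if "n \<in> {1..rank C}" for n
    using mu_pos[OF that] assms by simp
  from prod_inverse_le_1[of "{1..rank C}" "\<lambda>n. mu n * z * x powr (- alpha)", OF nonneg]
  show "0 \<le> rank_factor z x" unfolding rank_factor_def by simp
  from one_minus_prod_inverse_le[of "{1..rank C}" "\<lambda>n. mu n * z * x powr (- alpha)", OF nonneg]
  show "rank_factor z x \<le> (\<Sum>n = 1..rank C. mu n * z * x powr (- alpha))" unfolding rank_factor_def by simp
qed

lemma rank_factor_measurable [measurable (raw)]: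
  assumes [measurable]: "f \<in> borel_measurable N" "h \<in> borel_measurable N"
  shows "(\<lambda>x. rank_factor (f x) (h x)) \<in> borel_measurable N"
  unfolding rank_factor_def by measurable

lemma received_power_laplace:
  assumes z: "z \<ge> 0"
  shows "(\<integral>\<^sup>+\<omega>. ennreal (1 - exp (- (z * received_power \<omega>))) \<partial>M)
    = (\<integral>\<^sup>+x. ennreal (annulus_distance_density Rd x) * ennreal (rank_factor z x) \<partial>lborel)"
proof -
  let ?f = "\<lambda>(r, h). ennreal (1 - exp (- (z * ((norm (complex_matrix S *v h))\<^sup>2 * r powr (- alpha)))))"
  have "(\<integral>\<^sup>+\<omega>. ennreal (1 - exp (- (z * received_power \<omega>))) \<partial>M) = (\<integral>\<^sup>+\<omega>. ?f (d0 \<omega>, g 0 \<omega>) \<partial>M)"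
    by (simp add: received_power_def signal_gain_def fading_def)
  also have "\<dots> = (\<integral>\<^sup>+\<omega>. (\<integral>\<^sup>+\<omega>'. ?f (d0 \<omega>, g 0 \<omega>') \<partial>M) \<partial>M)"
    by (rule nn_integral_distance_fading) measurable
  also have "\<dots> = (\<integral>\<^sup>+\<omega>. ennreal (rank_factor z (d0 \<omega>)) \<partial>M)"
  proof (rule nn_integral_cong)
    fix \<omega>
    define s where "s = z * d0 \<omega> powr (- alpha)"
    have s: "s \<ge> 0" using z by (simp add: s_def)
    have [measurable]: "signal_gain S g \<in> borel_measurable M"
      unfolding signal_gain_def[abs_def] fading_def by measurable
    have le1: "exp (- (s * signal_gain S g \<omega>')) \<le> 1" for \<omega>'
      using s by (simp add: signal_gain_def)
    have "(\<integral>\<^sup>+\<omega>'. ?f (d0 \<omega>, g 0 \<omega>') \<partial>M) = (\<integral>\<^sup>+\<omega>'. 1 - ennreal (exp (- (s * signal_gain S g \<omega>'))) \<partial>M)"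
      by (intro nn_integral_cong)
        (simp add: s_def signal_gain_def fading_def mult_ac ennreal_minus[symmetric])
    \<comment> \<open>Subtraction in \<open>ennreal\<close> commutes with the integral because the
      subtracted integral is finite.\<close>
    also have "\<dots> = (\<integral>\<^sup>+\<omega>'. 1 \<partial>M) - (\<integral>\<^sup>+\<omega>'. ennreal (exp (- (s * signal_gain S g \<omega>'))) \<partial>M)"
      using le1 signal_gain_laplace[OF s] by (intro nn_integral_diff) (auto simp: ennreal_le_1)
    also have "\<dots> = 1 - ennreal (\<Prod>n = 1..rank C. 1 / (1 + mu n * s))"
      by (simp add: signal_gain_laplace[OF s] emeasure_space_1)
    also have "\<dots> = ennreal (rank_factor z (d0 \<omega>))"
    proof -
      have "0 \<le> (\<Prod>n = 1..rank C. 1 / (1 + mu n * s))"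
      proof (rule prod_nonneg)
        fix n assume "n \<in> {1..rank C}"
        then have "0 \<le> mu n * s" using mu_pos[of n] s by simp
        then show "0 \<le> 1 / (1 + mu n * s)" by simp
      qed
      from ennreal_minus[OF this, of 1] show ?thesis
        by (simp add: rank_factor_def s_def mult_ac)
    qed
    finally show "(\<integral>\<^sup>+\<omega>'. ?f (d0 \<omega>, g 0 \<omega>') \<partial>M) = ennreal (rank_factor z (d0 \<omega>))" .
  qed
  also have "\<dots> = (\<integral>\<^sup>+x. ennreal (annulus_distance_density Rd x) * ennreal (rank_factor z x) \<partial>lborel)"
    by (rule distributed_nn_integral[OF d0_density, symmetric]) measurable
  finally show ?thesis .
qed

text \<open>The inner radius 1 of the annulus bounds the path loss by 1, so the linear bound on
  \<open>rank_factor\<close> holds uniformly in the distance.\<close>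

lemma received_power_laplace_le:
  assumes z: "z \<ge> 0"
  shows "(\<integral>\<^sup>+\<omega>. ennreal (1 - exp (- (z * received_power \<omega>))) \<partial>M) \<le> ennreal (z * (\<Sum>n = 1..rank C. mu n))"
proof -
  have "(\<integral>\<^sup>+\<omega>. ennreal (1 - exp (- (z * received_power \<omega>))) \<partial>M)
    \<le> (\<integral>\<^sup>+x. ennreal (annulus_distance_density Rd x) * ennreal (z * (\<Sum>n = 1..rank C. mu n)) \<partial>lborel)"
    unfolding received_power_laplace[OF z]
  proof (rule nn_integral_mono)
    fix x
    show "ennreal (annulus_distance_density Rd x) * ennreal (rank_factor z x)
      \<le> ennreal (annulus_distance_density Rd x) * ennreal (z * (\<Sum>n = 1..rank C. mu n))"
    proof (cases "x \<ge> 1")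
      case True
      then have "x powr (- alpha) \<le> 1" using alpha powr_mono[of "- alpha" 0 x] by simp
      then have "(\<Sum>n = 1..rank C. mu n * z * x powr (- alpha)) \<le> (\<Sum>n = 1..rank C. mu n * z * 1)"
        using mu_pos z by (intro sum_mono mult_left_mono) (auto simp: less_imp_le)
      with rank_factor_bounds(2)[OF z, of x]
      have "rank_factor z x \<le> z * (\<Sum>n = 1..rank C. mu n)" by (simp add: sum_distrib_left mult.commute)
      then show ?thesis by (intro mult_left_mono ennreal_leI) auto
    qed (simp add: annulus_distance_density_def)
  qed
  also have "\<dots> = (\<integral>\<^sup>+\<omega>. ennreal (z * (\<Sum>n = 1..rank C. mu n)) \<partial>M)"
    by (rule distributed_nn_integral[OF d0_density]) measurable
  finally show ?thesis by (simp add: emeasure_space_1)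
qed

subsection \<open>Spectral efficiency\<close>

lemma interference_measurable [measurable]: "interference alpha S X g \<in> borel_measurable M"
  by (subst interference_eq[abs_def]) measurable

text \<open>Only almost surely: where the series diverges, the real \<open>suminf\<close> is an
  unspecified number.\<close>

lemma AE_interference_nonneg: "AE \<omega> in M. 0 \<le> interference alpha S X g \<omega>"
  using AE_summable_path_gain
  by eventually_elim (simp add: interference_eq suminf_nonneg path_gain_nonneg)

lemma SINR_mrc_eq:
  "SINR_mrc alpha SNR S d0 X g \<omega> = received_power \<omega> / (interference alpha S X g \<omega> + 1 / SNR)"
  by (simp add: SINR_mrc_def received_power_def)

text \<open>The integrand whose integral over z is ln (1 + SINR) wherever the interference is
  nonnegative.\<close>

definition log_kernel :: "real \<Rightarrow> 'w \<Rightarrow> ennreal" where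
  "log_kernel z \<omega> = ennreal ((1 - exp (- (z * received_power \<omega>))) *
     exp (- (z * (interference alpha S X g \<omega> + 1 / SNR))) / z) * indicator {0<..} z"

text \<open>Splits into a constant for fixed z, a weight at most 1 depending on the direct link, and
  the interference factor, as required by \<open>laplace_interference\<close>.\<close>

lemma log_kernel_eq:
  assumes "z > 0"
  shows "log_kernel z \<omega> = ennreal (exp (- (z / SNR)) / z) *
    (ennreal (1 - exp (- (z * received_power \<omega>))) * ennreal (exp (- (z * interference alpha S X g \<omega>))))"
proof -
  have "exp (- (z * (interference alpha S X g \<omega> + 1 / SNR)))
      = exp (- (z / SNR)) * exp (- (z * interference alpha S X g \<omega>))"
    by (simp add: exp_add[symmetric] algebra_simps)
  moreover have "0 \<le> 1 - exp (- (z * received_power \<omega>))"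
    using assms received_power_nonneg[of \<omega>] by simp
  ultimately show ?thesis
    using assms by (simp add: log_kernel_def ennreal_mult[symmetric] mult_ac)
qed

lemma nn_integral_ln_SINR:
  "(\<integral>\<^sup>+\<omega>. ennreal (ln (1 + SINR_mrc alpha SNR S d0 X g \<omega>)) \<partial>M)
    = (\<integral>\<^sup>+z. (\<integral>\<^sup>+\<omega>. log_kernel z \<omega> \<partial>M) \<partial>lborel)"
proof -
  interpret pair_sigma_finite M "lborel :: real measure" ..
  have "(\<integral>\<^sup>+\<omega>. ennreal (ln (1 + SINR_mrc alpha SNR S d0 X g \<omega>)) \<partial>M)
    = (\<integral>\<^sup>+\<omega>. (\<integral>\<^sup>+z. log_kernel z \<omega> \<partial>lborel) \<partial>M)"
  proof (rule nn_integral_cong_AE)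
    show "AE \<omega> in M. ennreal (ln (1 + SINR_mrc alpha SNR S d0 X g \<omega>)) = (\<integral>\<^sup>+z. log_kernel z \<omega> \<partial>lborel)"
      using AE_interference_nonneg
    proof eventually_elim
      fix \<omega> assume "0 \<le> interference alpha S X g \<omega>"
      then have "0 < interference alpha S X g \<omega> + 1 / SNR" using SNR by (simp add: add_nonneg_pos)
      from nn_integral_ln_one_plus[OF received_power_nonneg this]
      show "ennreal (ln (1 + SINR_mrc alpha SNR S d0 X g \<omega>)) = (\<integral>\<^sup>+z. log_kernel z \<omega> \<partial>lborel)"
        by (simp only: log_kernel_def SINR_mrc_eq)
    qed
  qed
  also have "\<dots> = (\<integral>\<^sup>+z. (\<integral>\<^sup>+\<omega>. log_kernel z \<omega> \<partial>M) \<partial>lborel)"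
    unfolding log_kernel_def by (rule Fubini'[symmetric]) measurable
  finally show ?thesis .
qed

text \<open>Dropping the interference factor leaves a mean of at most z m, which cancels 1 / z; the
  integral of m exp (- z / SNR) is m SNR.\<close>

lemma nn_integral_ln_SINR_finite:
  "(\<integral>\<^sup>+\<omega>. ennreal (ln (1 + SINR_mrc alpha SNR S d0 X g \<omega>)) \<partial>M) < \<infinity>"
proof -
  define m where "m = (\<Sum>n = 1..rank C. mu n)"
  have m: "m \<ge> 0" unfolding m_def using mu_pos by (intro sum_nonneg) (auto simp: less_imp_le)
  have "(\<integral>\<^sup>+\<omega>. log_kernel z \<omega> \<partial>M) \<le> ennreal m * (ennreal (exp (- (z * (1 / SNR)))) * indicator {0<..} z)" for z
  proof (cases "z > 0")
    case z: True
    have "(\<integral>\<^sup>+\<omega>. log_kernel z \<omega> \<partial>M)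
      \<le> (\<integral>\<^sup>+\<omega>. ennreal (exp (- (z / SNR)) / z) * ennreal (1 - exp (- (z * received_power \<omega>))) \<partial>M)"
    proof (rule nn_integral_mono_AE)
      show "AE \<omega> in M. log_kernel z \<omega> \<le> ennreal (exp (- (z / SNR)) / z) * ennreal (1 - exp (- (z * received_power \<omega>)))"
        using AE_interference_nonneg
      proof eventually_elim
        fix \<omega> assume "0 \<le> interference alpha S X g \<omega>"
        then have "ennreal (exp (- (z * interference alpha S X g \<omega>))) \<le> 1"
          using z by (simp add: ennreal_le_1)
        from mult_left_mono[OF this, of "ennreal (1 - exp (- (z * received_power \<omega>)))"]
        show "log_kernel z \<omega> \<le> ennreal (exp (- (z / SNR)) / z) * ennreal (1 - exp (- (z * received_power \<omega>)))"
          unfolding log_kernel_eq[OF z] by (intro mult_left_mono) auto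
      qed
    qed
    also have "\<dots> = ennreal (exp (- (z / SNR)) / z) * (\<integral>\<^sup>+\<omega>. ennreal (1 - exp (- (z * received_power \<omega>))) \<partial>M)"
      by (rule nn_integral_cmult) measurable
    also have "\<dots> \<le> ennreal (exp (- (z / SNR)) / z) * ennreal (z * m)"
      unfolding m_def using z by (intro mult_left_mono received_power_laplace_le) auto
    also have "\<dots> = ennreal m * (ennreal (exp (- (z * (1 / SNR)))) * indicator {0<..} z)"
      using z m by (simp add: ennreal_mult[symmetric] mult_ac)
    finally show ?thesis .
  qed (simp add: log_kernel_def)
  then have "(\<integral>\<^sup>+z. (\<integral>\<^sup>+\<omega>. log_kernel z \<omega> \<partial>M) \<partial>lborel)
    \<le> (\<integral>\<^sup>+z. ennreal m * (ennreal (exp (- (z * (1 / SNR)))) * indicator {0<..} z) \<partial>lborel)"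
    by (intro nn_integral_mono)
  also have "\<dots> = ennreal m * ennreal (1 / (1 / SNR))"
    using nn_integral_exp_Ioi[of "1 / SNR"] SNR by (subst nn_integral_cmult) simp_all
  also have "\<dots> < \<infinity>" by (simp add: ennreal_mult_less_top)
  finally show ?thesis unfolding nn_integral_ln_SINR .
qed

text \<open>With z moved outside, the comparison is made for each z separately: averaging the signal
  factor over the link gives \<open>rank_factor\<close> against the distance density.\<close>

lemma nn_integral_ln_SINR_ge:
  "(\<integral>\<^sup>+x. ennreal (annulus_distance_density Rd x) *
      (\<integral>\<^sup>+z. ennreal (rank_factor z x * laplace_bound z / (z * exp (z / SNR))) * indicator {0<..} z \<partial>lborel) \<partial>lborel)
    \<le> (\<integral>\<^sup>+\<omega>. ennreal (ln (1 + SINR_mrc alpha SNR S d0 X g \<omega>)) \<partial>M)"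
proof -
  have [measurable]: "annulus_distance_density Rd \<in> borel_measurable borel"
    unfolding annulus_distance_density_def[abs_def] by measurable
  have [measurable]: "laplace_bound \<in> borel_measurable borel"
    unfolding laplace_bound_def[abs_def] by measurable
  have lb: "0 \<le> laplace_bound z" for z by (simp add: laplace_bound_def)
  have "(\<integral>\<^sup>+x. ennreal (annulus_distance_density Rd x) *
      (\<integral>\<^sup>+z. ennreal (rank_factor z x * laplace_bound z / (z * exp (z / SNR))) * indicator {0<..} z \<partial>lborel) \<partial>lborel)
    = (\<integral>\<^sup>+x. (\<integral>\<^sup>+z. ennreal (annulus_distance_density Rd x) *
        (ennreal (rank_factor z x * laplace_bound z / (z * exp (z / SNR))) * indicator {0<..} z) \<partial>lborel) \<partial>lborel)"
    by (intro nn_integral_cong nn_integral_cmult[symmetric]) measurable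
  also have "\<dots> = (\<integral>\<^sup>+z. (\<integral>\<^sup>+x. ennreal (annulus_distance_density Rd x) *
        (ennreal (rank_factor z x * laplace_bound z / (z * exp (z / SNR))) * indicator {0<..} z) \<partial>lborel) \<partial>lborel)"
    by (rule lborel_pair.Fubini') measurable
  also have "\<dots> \<le> (\<integral>\<^sup>+z. (\<integral>\<^sup>+\<omega>. log_kernel z \<omega> \<partial>M) \<partial>lborel)"
  proof (rule nn_integral_mono)
    fix z :: real
    show "(\<integral>\<^sup>+x. ennreal (annulus_distance_density Rd x) *
        (ennreal (rank_factor z x * laplace_bound z / (z * exp (z / SNR))) * indicator {0<..} z) \<partial>lborel)
      \<le> (\<integral>\<^sup>+\<omega>. log_kernel z \<omega> \<partial>M)"
    proof (cases "z > 0")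
      case z: True
      let ?c = "ennreal (exp (- (z / SNR)) / z)"
      let ?W = "\<lambda>(r, h). ennreal (1 - exp (- (z * ((norm (complex_matrix S *v h))\<^sup>2 * r powr (- alpha)))))"
      have W: "ennreal (1 - exp (- (z * received_power \<omega>))) = ?W (d0 \<omega>, g 0 \<omega>)" for \<omega>
        by (simp add: received_power_def signal_gain_def fading_def)
      have "(\<integral>\<^sup>+x. ennreal (annulus_distance_density Rd x) *
          (ennreal (rank_factor z x * laplace_bound z / (z * exp (z / SNR))) * indicator {0<..} z) \<partial>lborel)
        = (\<integral>\<^sup>+x. (?c * ennreal (laplace_bound z)) * (ennreal (annulus_distance_density Rd x) * ennreal (rank_factor z x)) \<partial>lborel)"
      proof (rule nn_integral_cong)
        fix x
        have "rank_factor z x * laplace_bound z / (z * exp (z / SNR))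
            = exp (- (z / SNR)) / z * laplace_bound z * rank_factor z x"
          by (simp add: exp_minus field_simps)
        then have "ennreal (rank_factor z x * laplace_bound z / (z * exp (z / SNR)))
            = ?c * ennreal (laplace_bound z) * ennreal (rank_factor z x)"
          using z lb rank_factor_bounds(1)[of z x] by (simp add: ennreal_mult[symmetric])
        then show "ennreal (annulus_distance_density Rd x) *
            (ennreal (rank_factor z x * laplace_bound z / (z * exp (z / SNR))) * indicator {0<..} z)
          = (?c * ennreal (laplace_bound z)) * (ennreal (annulus_distance_density Rd x) * ennreal (rank_factor z x))"
          using z by (simp add: mult_ac)
      qed
      also have "\<dots> = (?c * ennreal (laplace_bound z)) * (\<integral>\<^sup>+x. ennreal (annulus_distance_density Rd x) * ennreal (rank_factor z x) \<partial>lborel)"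
        by (rule nn_integral_cmult) measurable
      also have "\<dots> = ?c * ((\<integral>\<^sup>+\<omega>. ?W (d0 \<omega>, g 0 \<omega>) \<partial>M) * ennreal (laplace_bound z))"
        unfolding received_power_laplace[OF less_imp_le[OF z], symmetric] W by (simp add: mult_ac)
      also have "\<dots> \<le> ?c * (\<integral>\<^sup>+\<omega>. ?W (d0 \<omega>, g 0 \<omega>) * ennreal (exp (- (z * interference alpha S X g \<omega>))) \<partial>M)"
      proof (rule mult_left_mono[OF laplace_interference[OF _ _ z]])
        show "?W \<in> borel_measurable (borel \<Otimes>\<^sub>M borel)" by measurable
        show "?W p \<le> 1" for p by (cases p) (simp add: ennreal_le_1)
      qed simp
      also have "\<dots> = (\<integral>\<^sup>+\<omega>. ?c * (ennreal (1 - exp (- (z * received_power \<omega>))) * ennreal (exp (- (z * interference alpha S X g \<omega>)))) \<partial>M)"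
        unfolding W[symmetric] by (rule nn_integral_cmult[symmetric]) measurable
      also have "\<dots> = (\<integral>\<^sup>+\<omega>. log_kernel z \<omega> \<partial>M)"
        by (simp only: log_kernel_eq[OF z])
      finally show ?thesis .
    qed (simp add: log_kernel_def)
  qed
  finally show ?thesis unfolding nn_integral_ln_SINR .
qed

lemma spectral_efficiency_ge:
  "lam / ln 2 * (LBINT x:{1..Rd}.
      (LBINT z:{0<..}. rank_factor z x * laplace_bound z / (z * exp (z / SNR))) * (2 * x / (Rd\<^sup>2 - 1)))
    \<le> sum_spectral_efficiency_mrc M lam alpha SNR S d0 X g"
proof -
  define G where "G = (\<lambda>x. LBINT z:{0<..}. rank_factor z x * laplace_bound z / (z * exp (z / SNR)))"
  let ?L = "\<lambda>\<omega>. ln (1 + SINR_mrc alpha SNR S d0 X g \<omega>)"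
  have lb: "0 \<le> laplace_bound z" for z by (simp add: laplace_bound_def)
  have int0: "0 \<le> indicator {0<..} z *\<^sub>R (rank_factor z x * laplace_bound z / (z * exp (z / SNR)))" for z x
    using rank_factor_bounds(1)[of z x] lb[of z] by (auto simp: indicator_def)
  have G0: "0 \<le> G x" for x
    unfolding G_def set_lebesgue_integral_def using int0 by (rule Bochner_Integration.integral_nonneg)
  have G_le: "ennreal (G x) \<le> (\<integral>\<^sup>+z. ennreal (rank_factor z x * laplace_bound z / (z * exp (z / SNR))) * indicator {0<..} z \<partial>lborel)" for x
  proof -
    have "ennreal (G x) \<le> (\<integral>\<^sup>+z. ennreal (indicator {0<..} z *\<^sub>R (rank_factor z x * laplace_bound z / (z * exp (z / SNR)))) \<partial>lborel)"
      unfolding G_def set_lebesgue_integral_def by (rule ennreal_integral_le_nn_integral[OF int0])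
    also have "\<dots> = (\<integral>\<^sup>+z. ennreal (rank_factor z x * laplace_bound z / (z * exp (z / SNR))) * indicator {0<..} z \<partial>lborel)"
      by (intro nn_integral_cong) (auto simp: indicator_def)
    finally show ?thesis .
  qed
  have Rd2: "Rd\<^sup>2 - 1 > 0" using Rd by (simp add: one_less_power)
  have dens: "indicator {1..Rd} x *\<^sub>R (G x * (2 * x / (Rd\<^sup>2 - 1))) = annulus_distance_density Rd x * G x"
    and dens0: "0 \<le> annulus_distance_density Rd x" for x
    using Rd2 by (auto simp: annulus_distance_density_def indicator_def)
  have "ennreal (LBINT x:{1..Rd}. G x * (2 * x / (Rd\<^sup>2 - 1)))
      \<le> (\<integral>\<^sup>+x. ennreal (annulus_distance_density Rd x * G x) \<partial>lborel)"
    unfolding set_lebesgue_integral_def dens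
    by (rule ennreal_integral_le_nn_integral) (simp add: G0 dens0)
  also have "\<dots> = (\<integral>\<^sup>+x. ennreal (annulus_distance_density Rd x) * ennreal (G x) \<partial>lborel)"
    by (simp add: ennreal_mult G0 dens0)
  also have "\<dots> \<le> (\<integral>\<^sup>+x. ennreal (annulus_distance_density Rd x) *
      (\<integral>\<^sup>+z. ennreal (rank_factor z x * laplace_bound z / (z * exp (z / SNR))) * indicator {0<..} z \<partial>lborel) \<partial>lborel)"
    by (intro nn_integral_mono mult_left_mono G_le) simp
  also have "\<dots> \<le> (\<integral>\<^sup>+\<omega>. ennreal (?L \<omega>) \<partial>M)"
    by (rule nn_integral_ln_SINR_ge)
  \<comment> \<open>Here an equality is indispensable: without integrability the expectation would
    have the default value 0.\<close>
  also have "\<dots> = ennreal (LINT \<omega>|M. ?L \<omega>)"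
  proof (rule nn_integral_eq_integral)
    have [measurable]: "(\<lambda>\<omega>. SINR_mrc alpha SNR S d0 X g \<omega>) \<in> borel_measurable M"
      unfolding SINR_mrc_eq by measurable
    show nonneg: "AE \<omega> in M. 0 \<le> ?L \<omega>"
      using AE_interference_nonneg
      by eventually_elim (use SNR received_power_nonneg in \<open>simp add: SINR_mrc_eq\<close>)
    show "integrable M ?L"
      using nn_integral_ln_SINR_finite nonneg by (intro integrableI_nonneg) auto
  qed
  finally have "(LBINT x:{1..Rd}. G x * (2 * x / (Rd\<^sup>2 - 1))) \<le> (LINT \<omega>|M. ?L \<omega>)"
  proof (subst (asm) ennreal_le_iff)
    show "0 \<le> (LINT \<omega>|M. ?L \<omega>)"
      using AE_interference_nonneg
      by (intro integral_nonneg_AE, eventually_elim) (use SNR received_power_nonneg in \<open>simp add: SINR_mrc_eq\<close>)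
  qed
  then have "lam / ln 2 * (LBINT x:{1..Rd}. G x * (2 * x / (Rd\<^sup>2 - 1))) \<le> lam / ln 2 * (LINT \<omega>|M. ?L \<omega>)"
    using lam by (intro mult_left_mono) auto
  also have "\<dots> = sum_spectral_efficiency_mrc M lam alpha SNR S d0 X g"
    by (simp add: sum_spectral_efficiency_mrc_def log_def)
  finally show ?thesis by (simp only: G_def)
qed

end

theorem theorem5:
  fixes M :: "'w measure"
    and lam alpha Rd SNR :: real
    and C S :: "real^'n^'n"
    and mu :: "nat \<Rightarrow> real"
    and d0 :: "'w \<Rightarrow> real"
    and X :: "nat \<Rightarrow> 'w \<Rightarrow> real^2"
    and g :: "nat \<Rightarrow> 'w \<Rightarrow> complex^'n"
  assumes "prob_space M"
    and "lam > 0" and "alpha > 2" and "Rd > 1" and "SNR > 0"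
    and C_psd: "psd_matrix C"
    and C_rank: "1 \<le> rank C"
    and C_sqrt: "is_psd_sqrt S C"
    and mu_pos: "\<And>n. n \<in> {1..rank C} \<Longrightarrow> mu n > 0"
    and mu_decreasing: "\<And>m n. 1 \<le> m \<Longrightarrow> m \<le> n \<Longrightarrow> n \<le> rank C \<Longrightarrow> mu n \<le> mu m"
    and mu_eigenvalues:
      "\<And>x. x \<noteq> 0 \<Longrightarrow> card {n \<in> {1..rank C}. mu n = x} = order x (charpoly C)"
    and d0_density:
      "distributed M lborel d0 (\<lambda>r. ennreal (annulus_distance_density Rd r))"
    and interferers_PPP: "homogeneous_PPP M lam X"
    and fading_measurable: "\<And>l. g l \<in> borel_measurable M"
    and fading_entries_indep:
      "\<And>l. prob_space.indep_vars M (\<lambda>_. borel) (\<lambda>i \<omega>. g l \<omega> $ i) (UNIV :: 'n set)"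
    and fading_entries_normal:
      "\<And>l i. distributed M lborel (\<lambda>\<omega>. g l \<omega> $ i)
                 (\<lambda>z. ennreal (std_complex_normal_density z))"
    and sources_indep:
      "prob_space.indep_sets M (\<lambda>s. sets (source_algebra M d0 X g s)) UNIV"
  shows "sum_spectral_efficiency_mrc M lam alpha SNR S d0 X g \<ge>
    lam / ln 2 *
      (LBINT x:{1..Rd}.
        (LBINT z:{0<..}.
          ((1 - (\<Prod>n = 1..rank C. 1 / (1 + mu n * z * x powr (- alpha)))) *
           exp (- (mu 1 powr (2 / alpha) * lam * pi / nsinc (2 / alpha)) * z powr (2 / alpha)))
          / (z * exp (z / SNR))) *
        (2 * x / (Rd\<^sup>2 - 1)))"
proof -
  interpret mrc_network M lam alpha Rd SNR C S mu d0 X g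
    by (rule mrc_network.intro[OF \<open>prob_space M\<close>], unfold_locales) (fact assms)+
  \<comment> \<open>The two forms differ by splitting the power of z * \<open>mu 1\<close>;
    agreement on the range of integration suffices.\<close>
  have bound: "laplace_bound z
      = exp (- (mu 1 powr (2 / alpha) * lam * pi / nsinc (2 / alpha)) * z powr (2 / alpha))" if "z > 0" for z
    using that mu1_pos by (simp add: laplace_bound_def powr_mult mult_ac)
  have "(LBINT z:{0<..}. rank_factor z x * laplace_bound z / (z * exp (z / SNR)))
    = (LBINT z:{0<..}.
          ((1 - (\<Prod>n = 1..rank C. 1 / (1 + mu n * z * x powr (- alpha)))) *
           exp (- (mu 1 powr (2 / alpha) * lam * pi / nsinc (2 / alpha)) * z powr (2 / alpha)))
          / (z * exp (z / SNR)))" for x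
    by (rule set_lebesgue_integral_cong) (auto simp: rank_factor_def bound)
  with spectral_efficiency_ge show ?thesis by (simp only:)
qed

end
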